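(* For any integers $k\ge1$ and $n>k$, $$\inf_{I\in\mathcal I_{k,n}}\frac{\mathsf{ST}(I)}{\mathsf{Proph}(I)}=\inf_{\mathbf G}\ \mathrm{innerLP}^{\mathsf{ST}/\mathsf{Proph}}_{k,n}(\mathbf G)\qquad\text{and}\qquad\inf_{I\in\mathcal I_{k,n}}\frac{\mathsf{ST}(I)}{\mathsf{ExAnte}(I)}=\inf_{\mathbf G}\ \mathrm{innerLP}^{\mathsf{ST}/\mathsf{ExAnte}}_{k,n}(\mathbf G),$$ where $\inf_{\mathbf G}$ is over all type distributions $\mathbf G$ for $n$ agents (with any finite number $m$ of types).
   Context: $[n]=\{1,\dots,n\}$. $\mathrm{Ber}(p)$ is a Bernoulli random variable with mean $p$, independent within sums. Instances. $\mathcal I_{k,n}$ is the class of all instances $I$ with $k$ slots and $n$ agents: a positive integer $m$ (number of types), valuations $r_1\ge\cdots\ge r_m\ge0$, and probabilities $p_{ij}\ge0$ ($i\in[n],j\in[m]$) with $\sum_{j=1}^mp_{ij}=1$ for each $i$. Agents arrive in order $1,\dots,n$; agent $i$ independently has type $j$ with probability $p_{ij}$, and then valuation $R_i=r_j$. The static threshold policy $(J,\rho)$, $J\in[m]$, $\rho\in(0,1]$: while slots remain (out of $k$), accept each arriving agent of type $j<J$, accept each arriving agent of type exactly $J$ according to an independent coin flip of probability $\rho$, reject all others. $\mathsf{ST}(I)$ is the supremum over $(J,\rho)$ (chosen with full knowledge of $I$) of the expected total valuation of agents accepted by policy $(J,\rho)$. $\mathsf{Proph}(I)=\mathbb E[\max_{S\subseteq[n],|S|\le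 k}\sum_{i\in S}R_i]$. $\mathsf{ExAnte}(I)=\max\{\sum_{j=1}^mr_ja_j:\ \sum_{j=1}^ma_j\le k,\ 0\le a_j\le\sum_{i=1}^np_{ij}\ \forall j\in[m]\}$. Infima of ratios are over instances with positive denominator. Type distributions $\mathbf G$ (for $n$ agents): a positive integer $m$ and numbers $G_{ij}$, $i\in[n]$, $j\in\{0,\dots,m\}$, with $0=G_{i0}\le G_{i1}\le\cdots\le G_{im}=1$ for every $i$. For $J\in[m]$, $\rho\in(0,1]$ define arrays $x^l_i(J,\rho),y^l_i(J,\rho)$ ($i\in[n],l\in[k]$) by $y^l_i(J,\rho)=((1-\rho)G_{i,J-1}+\rho G_{iJ})x^l_i(J,\rho)$; $x^k_1(J,\rho)=1$; $x^l_1(J,\rho)=0$ for $l<k$; $x^l_i(J,\rho)=x^l_{i-1}(J,\rho)-y^l_{i-1}(J,\rho)+y^{l+1}_{i-1}(J,\rho)$ for $i>1$ (with $y^{k+1}_i=0$). $\mathrm{innerLP}^{\mathsf{ST}/\mathsf{Proph}}_{k,n}(\mathbf G)$ (resp. $\mathrm{innerLP}^{\mathsf{ST}/\mathsf{ExAnte}}_{k,n}(\mathbf G)$) is the optimal value (supremum) of $\theta$ over real $\theta$ and probability measures $\mu$ on $[m]\times(0,1]$ subject to $$\theta\cdot Q_j\le\int\Big(\sum_{i=1}^n\sum_{l=1}^k\min\{y^l_i(J,\rho),G_{ij}x^l_i(J,\rho)\}\Big)d\mu(J,\rho)\quad\forall j\in[m],$$ where $Q_j=\mathbb E[\min\{\sum_{i=1}^n\mathrm{Ber}(G_{ij}),k\}]$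 (resp. $Q_j=\min\{\sum_{i=1}^nG_{ij},k\}$). *)

theory Defs
  imports "HOL-Probability.Probability"
begin

text \<open>
  Agents, types and slots are indexed by natural numbers starting from 1. An instance consists of
  \<open>m\<close>, \<open>r\<close> and \<open>p\<close>; only the values \<open>r j\<close> and \<open>p i j\<close> with \<open>i \<in> {1..n}\<close> and \<open>j \<in> {1..m}\<close>
  matter. All suprema and infima below are taken in the reals, over sets that are nonempty and
  bounded on the relevant side whenever \<open>1 \<le> k \<le> n\<close> and the data are valid.
\<close>

definition is_instance :: "nat \<Rightarrow> nat \<Rightarrow> (nat \<Rightarrow> real) \<Rightarrow> (nat \<Rightarrow> nat \<Rightarrow> real) \<Rightarrow> bool" where
  "is_instance n m r p \<longleftrightarrow>
     m \<ge> 1 \<and>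
     (\<forall>j\<in>{1..m}. r j \<ge> 0) \<and>
     (\<forall>j\<in>{1..m}. \<forall>j'\<in>{1..m}. j \<le> j' \<longrightarrow> r j' \<le> r j) \<and>
     (\<forall>i\<in>{1..n}. \<forall>j\<in>{1..m}. p i j \<ge> 0) \<and>
     (\<forall>i\<in>{1..n}. (\<Sum>j=1..m. p i j) = 1)"

definition type_pmf :: "nat \<Rightarrow> (nat \<Rightarrow> nat \<Rightarrow> real) \<Rightarrow> nat \<Rightarrow> nat pmf" where
  "type_pmf m p i = embed_pmf (\<lambda>j. if j \<in> {1..m} then p i j else 0)"

lemma pmf_type_pmf:
  assumes "is_instance n m r p" and "i \<in> {1..n}"
  shows "pmf (type_pmf m p i) j = (if j \<in> {1..m} then p i j else 0)"
  unfolding type_pmf_def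
proof (rule pmf_embed_pmf)
  show nonneg: "0 \<le> (if j \<in> {1..m} then p i j else 0)" for j
    using assms by (auto simp: is_instance_def)
  have "(\<integral>\<^sup>+ j. ennreal (if j \<in> {1..m} then p i j else 0) \<partial>count_space UNIV) =
        (\<Sum>j\<in>{1..m}. ennreal (if j \<in> {1..m} then p i j else 0))"
    by (rule nn_integral_count_space') (auto split: if_splits)
  also have "\<dots> = ennreal (\<Sum>j\<in>{1..m}. (if j \<in> {1..m} then p i j else 0))"
    using nonneg by (intro sum_ennreal) blast
  also have "(\<Sum>j\<in>{1..m}. (if j \<in> {1..m} then p i j else 0)) = 1"
  proof -
    have "(\<Sum>j\<in>{1..m}. (if j \<in> {1..m} then p i j else 0)) = (\<Sum>j\<in>{1..m}. p i j)"
      by (rule sum.cong) auto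
    then show ?thesis
      using assms by (simp add: is_instance_def)
  qed
  finally show "(\<integral>\<^sup>+ j. ennreal (if j \<in> {1..m} then p i j else 0) \<partial>count_space UNIV) = 1"
    by simp
qed

text \<open>The joint law of the (independent) types of the agents.\<close>

definition types_pmf :: "nat \<Rightarrow> nat \<Rightarrow> (nat \<Rightarrow> nat \<Rightarrow> real) \<Rightarrow> (nat \<Rightarrow> nat) pmf" where
  "types_pmf n m p = Pi_pmf {1..n} 0 (type_pmf m p)"

text \<open>
  The set of agents among \<open>1, \<dots>, i\<close> accepted by the static threshold policy with threshold type
  \<open>J\<close>, where agent \<open>i\<close> has type \<open>t i\<close>. A coin \<open>c i\<close> is provided for every agent, but it is consulted
  only if the agent has type exactly \<open>J\<close>.
\<close>

primrec accepted :: "nat \<Rightarrow> nat \<Rightarrow> (nat \<Rightarrow> nat) \<Rightarrow> (nat \<Rightarrow> bool) \<Rightarrow> nat \<Rightarrow> nat set" where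
  "accepted k J t c 0 = {}"
| "accepted k J t c (Suc i) =
     (if card (accepted k J t c i) < k \<and> (t (Suc i) < J \<or> t (Suc i) = J \<and> c (Suc i))
      then insert (Suc i) (accepted k J t c i)
      else accepted k J t c i)"

definition policy_value ::
    "nat \<Rightarrow> nat \<Rightarrow> nat \<Rightarrow> (nat \<Rightarrow> real) \<Rightarrow> (nat \<Rightarrow> nat \<Rightarrow> real) \<Rightarrow> nat \<Rightarrow> real \<Rightarrow> real" where
  "policy_value k n m r p J \<rho> =
     measure_pmf.expectation
       (pair_pmf (types_pmf n m p) (Pi_pmf {1..n} False (\<lambda>_. bernoulli_pmf \<rho>)))
       (\<lambda>(t, c). \<Sum>i\<in>accepted k J t c n. r (t i))"

definition ST :: "nat \<Rightarrow> nat \<Rightarrow> nat \<Rightarrow> (nat \<Rightarrow> real) \<Rightarrow> (nat \<Rightarrow> nat \<Rightarrow> real) \<Rightarrow> real" where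
  "ST k n m r p = (SUP (J, \<rho>)\<in>{1..m} \<times> {0<..1}. policy_value k n m r p J \<rho>)"

definition Proph :: "nat \<Rightarrow> nat \<Rightarrow> nat \<Rightarrow> (nat \<Rightarrow> real) \<Rightarrow> (nat \<Rightarrow> nat \<Rightarrow> real) \<Rightarrow> real" where
  "Proph k n m r p =
     measure_pmf.expectation (types_pmf n m p)
       (\<lambda>t. Max ((\<lambda>S. \<Sum>i\<in>S. r (t i)) ` {S. S \<subseteq> {1..n} \<and> card S \<le> k}))"

text \<open>The feasible region is compact and nonempty, so this supremum is a maximum.\<close>

definition ExAnte :: "nat \<Rightarrow> nat \<Rightarrow> nat \<Rightarrow> (nat \<Rightarrow> real) \<Rightarrow> (nat \<Rightarrow> nat \<Rightarrow> real) \<Rightarrow> real" where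
  "ExAnte k n m r p =
     Sup {(\<Sum>j=1..m. r j * a j) | a :: nat \<Rightarrow> real.
            (\<Sum>j=1..m. a j) \<le> real k \<and>
            (\<forall>j\<in>{1..m}. 0 \<le> a j \<and> a j \<le> (\<Sum>i=1..n. p i j))}"

definition is_type_dist :: "nat \<Rightarrow> nat \<Rightarrow> (nat \<Rightarrow> nat \<Rightarrow> real) \<Rightarrow> bool" where
  "is_type_dist n m G \<longleftrightarrow>
     m \<ge> 1 \<and>
     (\<forall>i\<in>{1..n}. G i 0 = 0 \<and> (\<forall>j<m. G i j \<le> G i (Suc j)) \<and> G i m = 1)"

text \<open>
  The arguments of \<open>x_arr\<close> and \<open>y_arr\<close> are \<open>k\<close>, \<open>G\<close>, \<open>J\<close>, \<open>\<rho>\<close>, the agent \<open>i\<close> and the slot level \<open>l\<close>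
  (a superscript on paper). The value at \<open>i = 0\<close> is a dummy.
\<close>

fun x_arr :: "nat \<Rightarrow> (nat \<Rightarrow> nat \<Rightarrow> real) \<Rightarrow> nat \<Rightarrow> real \<Rightarrow> nat \<Rightarrow> nat \<Rightarrow> real"
  and y_arr :: "nat \<Rightarrow> (nat \<Rightarrow> nat \<Rightarrow> real) \<Rightarrow> nat \<Rightarrow> real \<Rightarrow> nat \<Rightarrow> nat \<Rightarrow> real" where
  "x_arr k G J \<rho> 0 l = 0"
| "x_arr k G J \<rho> (Suc 0) l = (if l = k then 1 else 0)"
| "x_arr k G J \<rho> (Suc (Suc i)) l =
     x_arr k G J \<rho> (Suc i) l - y_arr k G J \<rho> (Suc i) l
       + (if l = k then 0 else y_arr k G J \<rho> (Suc i) (Suc l))"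
| "y_arr k G J \<rho> i l = ((1 - \<rho>) * G i (J - 1) + \<rho> * G i J) * x_arr k G J \<rho> i l"

text \<open>
  The optimal value of the inner linear program, with the coefficients \<open>Q j\<close> left open. The measure
  \<open>\<mu>\<close> ranges over the Borel probability measures on \<open>{1..m} \<times> {0<..1}\<close>; the integrand is bounded
  and measurable.
\<close>

definition innerLP :: "nat \<Rightarrow> nat \<Rightarrow> nat \<Rightarrow> (nat \<Rightarrow> nat \<Rightarrow> real) \<Rightarrow> (nat \<Rightarrow> real) \<Rightarrow> real" where
  "innerLP k n m G Q =
     Sup {\<theta>. \<exists>\<mu> :: (nat \<times> real) measure.
            prob_space \<mu> \<and>
            sets \<mu> = sets (count_space {1..m} \<Otimes>\<^sub>M restrict_space borel {0<..1}) \<and>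
            (\<forall>j\<in>{1..m}.
               \<theta> * Q j \<le>
                 (\<integral>(J, \<rho>). (\<Sum>i=1..n. \<Sum>l=1..k.
                     min (y_arr k G J \<rho> i l) (G i j * x_arr k G J \<rho> i l)) \<partial>\<mu>))}"

definition Q_Proph :: "nat \<Rightarrow> nat \<Rightarrow> (nat \<Rightarrow> nat \<Rightarrow> real) \<Rightarrow> nat \<Rightarrow> real" where
  "Q_Proph k n G j =
     measure_pmf.expectation (Pi_pmf {1..n} False (\<lambda>i. bernoulli_pmf (G i j)))
       (\<lambda>b. min (\<Sum>i=1..n. of_bool (b i)) (real k))"

definition Q_ExAnte :: "nat \<Rightarrow> nat \<Rightarrow> (nat \<Rightarrow> nat \<Rightarrow> real) \<Rightarrow> nat \<Rightarrow> real" where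
  "Q_ExAnte k n G j = min (\<Sum>i=1..n. G i j) (real k)"

definition innerLP_ST_Proph :: "nat \<Rightarrow> nat \<Rightarrow> nat \<Rightarrow> (nat \<Rightarrow> nat \<Rightarrow> real) \<Rightarrow> real" where
  "innerLP_ST_Proph k n m G = innerLP k n m G (Q_Proph k n G)"

definition innerLP_ST_ExAnte :: "nat \<Rightarrow> nat \<Rightarrow> nat \<Rightarrow> (nat \<Rightarrow> nat \<Rightarrow> real) \<Rightarrow> real" where
  "innerLP_ST_ExAnte k n m G = innerLP k n m G (Q_ExAnte k n G)"

end

theory Submission
  imports Defs
begin

text \<open>
  Write \<open>\<Delta> j = r j - r (j + 1)\<close> (with \<open>r (m + 1) = 0\<close>) and let \<open>G\<close> be the row-wise partial sums of \<open>p\<close>.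
  By Abel summation the value of every policy, the prophet value and the ex-ante value are linear in
  \<open>\<Delta> \<ge> 0\<close>, with coefficients depending on \<open>G\<close> only: the expected number of accepted agents of type
  at most \<open>j\<close>, and \<open>Q j\<close>. For fixed \<open>G\<close>, minimising the ratio over \<open>\<Delta>\<close> is therefore the linear program
  dual to the inner one, and the two infima agree because there is no duality gap. Since the dimension
  \<open>m\<close> is not a type, strong duality is obtained without a separating hyperplane theorem: the residuals
  of a near-minimiser, over mixed policies, of the squared violation of the constraints serve as \<open>\<Delta>\<close>.
\<close>

subsection \<open>Approximate linear programming duality\<close>

lemma finite_set_bool_pmf: "finite (set_pmf (M :: bool pmf))"
  by (rule finite_subset[of _ UNIV]) auto

lemma expectation_bind_pmf_finite:
  fixes h :: "'b \<Rightarrow> real"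
  assumes "finite (set_pmf p)" "\<And>x. x \<in> set_pmf p \<Longrightarrow> finite (set_pmf (f x))"
  shows "measure_pmf.expectation (bind_pmf p f) h =
         measure_pmf.expectation p (\<lambda>x. measure_pmf.expectation (f x) h)"
  by (subst pmf_expectation_bind[OF assms order_refl], simp,
      subst integral_measure_pmf[OF assms(1)]) auto

text \<open>A coin flip realises the segment from \<open>p\<close> to the point mass at
  \<open>x\<close>, along which expectations are affine. This makes the finitely supported laws a
  convex set to descend in.\<close>

lemma expectation_mix_pmf:
  fixes f :: "'a \<Rightarrow> real"
  assumes "finite (set_pmf p)" "0 \<le> s" "s \<le> 1"
  shows "measure_pmf.expectation
           (bind_pmf (bernoulli_pmf s) (\<lambda>b. if b then return_pmf x else p)) f =
         (1 - s) * measure_pmf.expectation p f + s * f x"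
  using assms by (subst expectation_bind_pmf_finite) auto

lemma expectation_pmf_mem_Icc:
  fixes f :: "'a \<Rightarrow> real"
  assumes "finite (set_pmf p)" "\<And>x. x \<in> set_pmf p \<Longrightarrow> a \<le> f x \<and> f x \<le> b"
  shows "a \<le> measure_pmf.expectation p f \<and> measure_pmf.expectation p f \<le> b"
proof
  have i: "integrable (measure_pmf p) f"
    using assms(1) by (rule integrable_measure_pmf_finite)
  have ae: "AE x in measure_pmf p. a \<le> f x" "AE x in measure_pmf p. f x \<le> b"
    using assms(2) by (auto simp: AE_measure_pmf_iff)
  show "a \<le> measure_pmf.expectation p f"
    by (rule measure_pmf.integral_ge_const[OF i ae(1)])
  show "measure_pmf.expectation p f \<le> b"
    by (rule measure_pmf.integral_le_const[OF i ae(2)])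
qed

text \<open>The squared positive part lies below its quadratic expansion with slope
  \<open>2 * max 0 x\<close>: \<open>max 0 (x - h)\<close> is the distance from \<open>x - h\<close>
  to the nonpositive half-line, so it is at most the distance to the point \<open>min 0 x\<close>,
  which is \<open>\<bar>max 0 x - h\<bar>\<close>.\<close>

lemma hinge_sq_step:
  fixes x h :: real
  shows "(max 0 (x - h))^2 \<le> (max 0 x)^2 - 2 * h * max 0 x + h^2"
proof -
  have "\<bar>max 0 (x - h)\<bar> \<le> \<bar>max 0 x - h\<bar>"
    by (auto simp: max_def)
  then have "(max 0 (x - h))^2 \<le> (max 0 x - h)^2"
    by (simp only: abs_le_square_iff)
  then show ?thesis by (simp add: power2_diff algebra_simps)
qed

text \<open>The target \<open>v + e\<close> is out of reach for mixtures, so the squared violation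
  \<open>\<Phi>\<close> stays away from 0. At a near-minimiser \<open>p\<close> no move towards a
  point \<open>x\<close> gains much; to first order this bounds
  \<open>\<Sum>j\<in>A. \<Delta> j * (c x j - u p j)\<close>. The gap between \<open>b\<close> and
  \<open>u p\<close>, weighted by the residuals \<open>\<Delta>\<close>, is \<open>\<Phi> p\<close>
  and pays for the error.\<close>

lemma approximate_lp_duality:
  fixes c :: "'a \<Rightarrow> nat \<Rightarrow> real" and Q :: "nat \<Rightarrow> real"
  assumes A: "finite A" "A \<noteq> {}" and X: "X \<noteq> {}"
    and c: "\<And>x j. x \<in> X \<Longrightarrow> j \<in> A \<Longrightarrow> 0 \<le> c x j \<and> c x j \<le> B"
    and Q: "\<And>j. j \<in> A \<Longrightarrow> 0 < Q j"
    and v: "\<And>p \<theta>. finite (set_pmf p) \<Longrightarrow> set_pmf p \<subseteq> X \<Longrightarrow>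
               (\<And>j. j \<in> A \<Longrightarrow> \<theta> * Q j \<le> measure_pmf.expectation p (\<lambda>x. c x j)) \<Longrightarrow> \<theta> \<le> v"
    and e: "e > 0"
  obtains \<Delta> where "\<And>j. j \<in> A \<Longrightarrow> 0 \<le> \<Delta> j" "0 < (\<Sum>j\<in>A. \<Delta> j * Q j)"
    "\<And>x. x \<in> X \<Longrightarrow> (\<Sum>j\<in>A. \<Delta> j * c x j) \<le> (v + e) * (\<Sum>j\<in>A. \<Delta> j * Q j)"
proof -
  define P where "P = {p. finite (set_pmf p) \<and> set_pmf p \<subseteq> X}"
  define u where "u p j = measure_pmf.expectation p (\<lambda>x. c x j)" for p j
  define b where "b j = (v + e) * Q j" for j
  define \<Phi> where "\<Phi> p = (\<Sum>j\<in>A. (max 0 (b j - u p j))^2)" for p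
  define q where "q = Min (Q ` A)"
  have q: "q > 0" "\<And>j. j \<in> A \<Longrightarrow> q \<le> Q j"
    using A Q by (auto simp: q_def)
  \<comment> \<open>Some constraint already fails at the target \<open>v + e / 2\<close>, so at
    \<open>v + e\<close> it is violated by at least \<open>e / 2 * q\<close>.\<close>
  define d where "d = (e / 2 * q)^2"
  have d0: "d > 0" using e q by (simp add: d_def)
  have d: "d \<le> \<Phi> p" if p: "p \<in> P" for p
  proof -
    have "\<not> (\<forall>j\<in>A. (v + e / 2) * Q j \<le> u p j)"
      using v[of p "v + e / 2"] p e by (auto simp: P_def u_def)
    then obtain j where j: "j \<in> A" "u p j < (v + e / 2) * Q j" by force
    have "e / 2 * q \<le> e / 2 * Q j" using q(2)[OF j(1)] e by (intro mult_left_mono) auto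
    also have "\<dots> \<le> b j - u p j" using j(2) by (simp add: b_def algebra_simps)
    finally have "e / 2 * q \<le> max 0 (b j - u p j)" by linarith
    then have "d \<le> (max 0 (b j - u p j))^2"
      unfolding d_def using e q by (intro power_mono) auto
    also have "\<dots> \<le> \<Phi> p"
      unfolding \<Phi>_def using A j by (intro member_le_sum) auto
    finally show ?thesis .
  qed
  have u: "0 \<le> u p j \<and> u p j \<le> B" if "p \<in> P" "j \<in> A" for p j
    unfolding u_def using that c by (intro expectation_pmf_mem_Icc) (auto simp: P_def)
  define M where "M = real (card A) * B^2"
  have M0: "M \<ge> 0" by (simp add: M_def)
  \<comment> \<open>The step length, capped at 1 to be a probability. The defect \<open>t^2\<close>
    of near-minimality and the quadratic term \<open>t^2 * M\<close> add up to
    \<open>t^2 * (1 + M)\<close>; after division by \<open>t\<close> this must not exceed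
    \<open>2 * d\<close>.\<close>
  define t where "t = min 1 (2 * d / (1 + M))"
  have t: "0 < t" "t \<le> 1" using d0 M0 by (auto simp: t_def)
  have "t \<le> 2 * d / (1 + M)" by (simp add: t_def)
  then have tM: "t * (1 + M) \<le> 2 * d" using M0 by (simp add: field_simps)
  obtain x0 where "x0 \<in> X" using X by auto
  then have "return_pmf x0 \<in> P" by (simp add: P_def)
  then have ne: "\<Phi> ` P \<noteq> {}" by auto
  have bdd: "bdd_below (\<Phi> ` P)" using d by (auto intro!: bdd_belowI[of _ d])
  have "\<exists>p\<in>P. \<Phi> p < Inf (\<Phi> ` P) + t^2"
    using cInf_lessD[OF ne, of "Inf (\<Phi> ` P) + t^2"] t by auto
  then obtain p where p: "p \<in> P" and near: "\<Phi> p < Inf (\<Phi> ` P) + t^2" by auto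
  define \<Delta> where "\<Delta> j = max 0 (b j - u p j)" for j
  \<comment> \<open>Termwise \<open>\<Delta> j * (b j - u p j) = (\<Delta> j)^2\<close>, because
    \<open>\<Delta> j\<close> vanishes where the constraint holds.\<close>
  have \<Delta>b: "(\<Sum>j\<in>A. \<Delta> j * u p j) = (\<Sum>j\<in>A. \<Delta> j * b j) - \<Phi> p"
    unfolding \<Phi>_def sum_subtractf[symmetric]
    by (intro sum.cong refl) (auto simp: \<Delta>_def max_def power2_eq_square algebra_simps)
  have key: "(\<Sum>j\<in>A. \<Delta> j * c x j) \<le> (\<Sum>j\<in>A. \<Delta> j * b j)" if x: "x \<in> X" for x
  proof -
    \<comment> \<open>Shifting mass \<open>t\<close> from \<open>p\<close> to \<open>x\<close>
      lowers \<open>\<Phi>\<close> by less than \<open>t^2\<close>, whereas the hinge estimate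
      bounds \<open>\<Phi> p'\<close> from above with the wanted sum as linear term.\<close>
    define p' where "p' = bind_pmf (bernoulli_pmf t) (\<lambda>b. if b then return_pmf x else p)"
    have "finite (set_pmf p')" "set_pmf p' \<subseteq> X"
      using p x by (auto simp: p'_def P_def split: if_splits)
    then have p': "p' \<in> P" by (simp add: P_def)
    have u': "u p' j = u p j + t * (c x j - u p j)" for j
      unfolding u_def p'_def using p t
      by (subst expectation_mix_pmf) (auto simp: P_def algebra_simps)
    have "\<Phi> p' \<le> (\<Sum>j\<in>A. (\<Delta> j)^2 - 2 * (t * (c x j - u p j)) * \<Delta> j + (t * (c x j - u p j))^2)"
      unfolding \<Phi>_def
    proof (rule sum_mono)
      fix j assume "j \<in> A"
      show "(max 0 (b j - u p' j))^2 \<le>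
          (\<Delta> j)^2 - 2 * (t * (c x j - u p j)) * \<Delta> j + (t * (c x j - u p j))^2"
        using hinge_sq_step[of "b j - u p j" "t * (c x j - u p j)"]
        by (simp add: u' \<Delta>_def algebra_simps)
    qed
    also have "\<dots> = \<Phi> p - 2 * t * (\<Sum>j\<in>A. (c x j - u p j) * \<Delta> j) + t^2 * (\<Sum>j\<in>A. (c x j - u p j)^2)"
      by (simp add: \<Phi>_def \<Delta>_def sum.distrib sum_subtractf sum_distrib_left power_mult_distrib mult.assoc)
    finally have 1: "\<Phi> p' \<le> \<Phi> p - 2 * t * (\<Sum>j\<in>A. (c x j - u p j) * \<Delta> j)
        + t^2 * (\<Sum>j\<in>A. (c x j - u p j)^2)" .
    have "(\<Sum>j\<in>A. (c x j - u p j)^2) \<le> (\<Sum>j\<in>A. B^2)"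
    proof (rule sum_mono)
      fix j assume j: "j \<in> A"
      have "\<bar>c x j - u p j\<bar> \<le> \<bar>B\<bar>"
        using c[OF x j] u[OF p j] by auto
      then show "(c x j - u p j)^2 \<le> B^2" by (simp only: abs_le_square_iff)
    qed
    also have "\<dots> = M" by (simp add: M_def)
    finally have 2: "t^2 * (\<Sum>j\<in>A. (c x j - u p j)^2) \<le> t^2 * M"
      by (intro mult_left_mono) auto
    have "Inf (\<Phi> ` P) \<le> \<Phi> p'" using bdd p' by (intro cInf_lower) auto
    with 1 2 near have "2 * t * (\<Sum>j\<in>A. (c x j - u p j) * \<Delta> j) \<le> t^2 * (1 + M)"
      by (simp add: algebra_simps)
    then have "t * (2 * (\<Sum>j\<in>A. (c x j - u p j) * \<Delta> j)) \<le> t * (t * (1 + M))"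
      by (simp add: power2_eq_square algebra_simps)
    then have "2 * (\<Sum>j\<in>A. (c x j - u p j) * \<Delta> j) \<le> t * (1 + M)"
      using t(1) by (simp only: mult_le_cancel_left_pos)
    then have "(\<Sum>j\<in>A. (c x j - u p j) * \<Delta> j) \<le> d" using tM by linarith
    moreover have "(\<Sum>j\<in>A. (c x j - u p j) * \<Delta> j) = (\<Sum>j\<in>A. \<Delta> j * c x j) - (\<Sum>j\<in>A. \<Delta> j * u p j)"
      by (simp add: sum_subtractf algebra_simps)
    \<comment> \<open>The excess of at most \<open>d\<close> is cancelled by
      \<open>\<Phi> p\<close>, which is at least \<open>d\<close>.\<close>
    ultimately show ?thesis using \<Delta>b d[OF p] by linarith
  qed
  have 3: "(\<Sum>j\<in>A. \<Delta> j * b j) = (v + e) * (\<Sum>j\<in>A. \<Delta> j * Q j)"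
    by (simp add: b_def sum_distrib_left mult_ac)
  have "\<exists>j\<in>A. \<Delta> j > 0"
  proof (rule ccontr)
    assume "\<not> ?thesis"
    then have "\<Phi> p = 0"
      unfolding \<Phi>_def \<Delta>_def by (intro sum.neutral) (auto simp: not_less)
    with d[OF p] d0 show False by simp
  qed
  then obtain j where "j \<in> A" "\<Delta> j > 0" by auto
  moreover have "\<Delta> i \<ge> 0" for i by (simp add: \<Delta>_def)
  ultimately have "0 < (\<Sum>j\<in>A. \<Delta> j * Q j)"
    using A Q by (intro sum_pos2[of _ j]) (auto intro!: mult_nonneg_nonneg simp: less_imp_le)
  then show thesis
    using key 3 that[of \<Delta>] by (auto simp: \<Delta>_def)
qed

subsection \<open>Abel summation and the value of a policy\<close>

text \<open>These are the drops \<open>\<Delta>\<close>. The value after the last type is set to 0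
  explicitly, since an instance says nothing about \<open>r (Suc m)\<close>.\<close>

definition drop_val :: "nat \<Rightarrow> (nat \<Rightarrow> real) \<Rightarrow> nat \<Rightarrow> real" where
  "drop_val m r j = r j - (if j < m then r (Suc j) else 0)"

lemma sum_drop_val:
  assumes "a \<le> m"
  shows "(\<Sum>j=a..m. drop_val m r j) = r a"
  using assms
proof (induction rule: inc_induct)
  case base
  then show ?case by (simp add: drop_val_def)
next
  case (step a)
  then have "(\<Sum>j=a..m. drop_val m r j) = drop_val m r a + (\<Sum>j=Suc a..m. drop_val m r j)"
    by (intro sum.atLeast_Suc_atMost) auto
  with step show ?case by (simp add: drop_val_def)
qed

text \<open>Abel summation: expand \<open>r a\<close> as the sum of the drops from \<open>a\<close>
  on and exchange the sums over the triangle \<open>a \<le> j\<close>.\<close>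

lemma sum_mult_drop_val:
  "(\<Sum>a=1..m. w a * r a) = (\<Sum>j=1..m. drop_val m r j * (\<Sum>a=1..j. w a))"
proof -
  have "(\<Sum>a=1..m. w a * r a) = (\<Sum>a=1..m. \<Sum>j=a..m. w a * drop_val m r j)"
    by (intro sum.cong refl) (simp add: sum_drop_val flip: sum_distrib_left)
  also have "\<dots> = (\<Sum>j=1..m. \<Sum>a=1..j. w a * drop_val m r j)"
    by (subst (1 2) sum.Sigma) (auto intro!: sum.reindex_bij_witness[of _ "\<lambda>(j, a). (a, j)" "\<lambda>(a, j). (j, a)"])
  finally show ?thesis by (simp add: sum_distrib_left mult_ac)
qed

section \<open>Distribution functions, acceptance probabilities and the slot arrays\<close>

text \<open>A relation rather than a function, because it is used in both directions: from an
  instance to its partial sums, and from a type distribution to an instance built on it.\<close>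

definition is_cdf_of :: "nat \<Rightarrow> nat \<Rightarrow> (nat \<Rightarrow> nat \<Rightarrow> real) \<Rightarrow> (nat \<Rightarrow> nat \<Rightarrow> real) \<Rightarrow> bool" where
  "is_cdf_of n m p G \<longleftrightarrow> (\<forall>i\<in>{1..n}. \<forall>j\<le>m. G i j = (\<Sum>a=1..j. p i a))"

text \<open>The probability that type and coin of agent \<open>i\<close> pass the threshold,
  irrespective of free slots.\<close>

definition accept_prob :: "(nat \<Rightarrow> nat \<Rightarrow> real) \<Rightarrow> nat \<Rightarrow> real \<Rightarrow> nat \<Rightarrow> real" where
  "accept_prob G J \<rho> i = (1 - \<rho>) * G i (J - 1) + \<rho> * G i J"

text \<open>
  The expected number of accepted agents of type at most \<open>j\<close> (\<open>policy_value_eq_coverage\<close>).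
\<close>

definition coverage :: "nat \<Rightarrow> nat \<Rightarrow> (nat \<Rightarrow> nat \<Rightarrow> real) \<Rightarrow> nat \<times> real \<Rightarrow> nat \<Rightarrow> real" where
  "coverage k n G = (\<lambda>(J, \<rho>) j. \<Sum>i=1..n. \<Sum>l=1..k.
     min (y_arr k G J \<rho> i l) (G i j * x_arr k G J \<rho> i l))"

lemma is_type_dist_mono:
  assumes "is_type_dist n m G" "i \<in> {1..n}" "a \<le> b" "b \<le> m"
  shows "G i a \<le> G i b"
  using assms(3,4)
proof (induction rule: dec_induct)
  case (step b)
  then have "G i b \<le> G i (Suc b)" using assms(1,2) unfolding is_type_dist_def by (meson Suc_le_lessD)
  with step show ?case by simp
qed simp

lemma is_type_dist_mem_Icc:
  assumes "is_type_dist n m G" "i \<in> {1..n}" "j \<le> m"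
  shows "0 \<le> G i j \<and> G i j \<le> 1"
  using is_type_dist_mono[OF assms(1,2), of 0 j] is_type_dist_mono[OF assms(1,2), of j m] assms
  by (auto simp: is_type_dist_def)

lemma accept_prob_bounds:
  assumes G: "is_type_dist n m G" "i \<in> {1..n}" and J: "J \<in> {1..m}" and \<rho>: "0 \<le> \<rho>" "\<rho> \<le> 1"
  shows "G i (J - 1) \<le> accept_prob G J \<rho> i" "accept_prob G J \<rho> i \<le> G i J"
proof -
  have "G i (J - 1) \<le> G i J" using is_type_dist_mono[OF G, of "J - 1" J] J by auto
  then have "\<rho> * G i (J - 1) \<le> \<rho> * G i J" "(1 - \<rho>) * G i (J - 1) \<le> (1 - \<rho>) * G i J"
    using \<rho> by (auto intro!: mult_left_mono)
  then show "G i (J - 1) \<le> accept_prob G J \<rho> i" "accept_prob G J \<rho> i \<le> G i J"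
    by (auto simp: accept_prob_def algebra_simps)
qed

lemma accept_prob_mem_Icc:
  assumes "is_type_dist n m G" "i \<in> {1..n}" "J \<in> {1..m}" "0 \<le> \<rho>" "\<rho> \<le> 1"
  shows "0 \<le> accept_prob G J \<rho> i \<and> accept_prob G J \<rho> i \<le> 1"
  using accept_prob_bounds[OF assms] is_type_dist_mem_Icc[OF assms(1,2), of "J - 1"]
    is_type_dist_mem_Icc[OF assms(1,2), of J] assms(3) by force

lemma y_arr_eq: "y_arr k G J \<rho> i l = accept_prob G J \<rho> i * x_arr k G J \<rho> i l"
  by (simp add: accept_prob_def)

text \<open>Each new entry is a convex combination of the old entries at levels \<open>l\<close> and
  \<open>Suc l\<close> (of 0 instead of the latter at the top level), weighted by the acceptance
  probability.\<close>

lemma x_arr_mem_Icc: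
  assumes G: "is_type_dist n m G" and J: "J \<in> {1..m}" and \<rho>: "0 \<le> \<rho>" "\<rho> \<le> 1"
    and "i \<le> n"
  shows "0 \<le> x_arr k G J \<rho> i l \<and> x_arr k G J \<rho> i l \<le> 1"
  using \<open>i \<le> n\<close>
proof (induction i arbitrary: l rule: less_induct)
  case (less i)
  consider "i = 0" | "i = 1" | i' where "i = Suc (Suc i')"
    by (metis One_nat_def not0_implies_Suc)
  then show ?case
  proof cases
    case 3
    define q where "q = accept_prob G J \<rho> (Suc i')"
    define x where "x = x_arr k G J \<rho> (Suc i')"
    define z where "z = (if l = k then 0 else x (Suc l))"
    have q: "0 \<le> q" "q \<le> 1"
      using accept_prob_mem_Icc[OF G _ J \<rho>, of "Suc i'"] 3 less.prems by (auto simp: q_def)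
    have "0 \<le> x l" "x l \<le> 1" "0 \<le> x (Suc l)" "x (Suc l) \<le> 1"
      using less.IH[of "Suc i'"] less.prems 3 by (auto simp: x_def)
    then have x: "0 \<le> x l" "x l \<le> 1" "0 \<le> z" "z \<le> 1" by (auto simp: z_def)
    have eq: "x_arr k G J \<rho> i l = (1 - q) * x l + q * z"
      unfolding 3 by (simp add: y_arr_eq x_def q_def z_def algebra_simps del: y_arr.simps)
    have "(1 - q) * x l + q * z \<le> 1"
      by (rule convex_bound_le) (use x q in auto)
    then show ?thesis using x q eq by auto
  qed auto
qed

text \<open>The arrays are nonnegative, so they factor out of the minimum.\<close>

lemma coverage_eq_sum:
  assumes "is_type_dist n m G" "J \<in> {1..m}" "0 \<le> \<rho>" "\<rho> \<le> 1"
  shows "coverage k n G (J, \<rho>) j =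
    (\<Sum>i=1..n. (\<Sum>l=1..k. x_arr k G J \<rho> i l) * min (accept_prob G J \<rho> i) (G i j))"
  unfolding coverage_def prod.case y_arr_eq sum_distrib_right
proof (intro sum.cong refl)
  fix i l assume "i \<in> {1..n}"
  then have "0 \<le> x_arr k G J \<rho> i l" using x_arr_mem_Icc[OF assms, of i] by auto
  then show "min (accept_prob G J \<rho> i * x_arr k G J \<rho> i l) (G i j * x_arr k G J \<rho> i l) =
      x_arr k G J \<rho> i l * min (accept_prob G J \<rho> i) (G i j)"
    by (simp only: min_mult_distrib_left if_True mult.commute)
qed

lemma coverage_mem_Icc:
  assumes G: "is_type_dist n m G" and J: "J \<in> {1..m}" and \<rho>: "0 \<le> \<rho>" "\<rho> \<le> 1"
    and j: "j \<le> m"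
  shows "0 \<le> coverage k n G (J, \<rho>) j \<and> coverage k n G (J, \<rho>) j \<le> real n * real k"
proof
  have x: "0 \<le> x_arr k G J \<rho> i l" "x_arr k G J \<rho> i l \<le> 1" if "i \<in> {1..n}" for i l
    using x_arr_mem_Icc[OF G J \<rho>, of i] that by auto
  have g: "0 \<le> G i j" "G i j \<le> 1" if "i \<in> {1..n}" for i
    using is_type_dist_mem_Icc[OF G that j] by auto
  show "0 \<le> coverage k n G (J, \<rho>) j"
    unfolding coverage_def prod.case y_arr_eq
    using x g accept_prob_mem_Icc[OF G _ J \<rho>]
    by (intro sum_nonneg) auto
  have "coverage k n G (J, \<rho>) j \<le> (\<Sum>i=1..n. \<Sum>l=1..k. 1)"
    unfolding coverage_def prod.case
    using x g by (intro sum_mono min.coboundedI2 mult_le_one) auto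
  then show "coverage k n G (J, \<rho>) j \<le> real n * real k" by simp
qed

lemma continuous_on_x_arr: "continuous_on UNIV (\<lambda>\<rho>. x_arr k G J \<rho> i l)"
proof (induction i arbitrary: l rule: less_induct)
  case (less i)
  consider "i = 0" | "i = 1" | i' where "i = Suc (Suc i')"
    by (metis One_nat_def not0_implies_Suc)
  then show ?case
  proof cases
    case 3
    then show ?thesis
      using less[of "Suc i'" l] less[of "Suc i'" "Suc l"]
      by (cases "l = k") (auto intro!: continuous_intros)
  qed auto
qed

section \<open>Measurability over the policy space\<close>

abbreviation policy_space :: "nat \<Rightarrow> (nat \<times> real) measure" where
  "policy_space m \<equiv> count_space {1..m} \<Otimes>\<^sub>M restrict_space borel {0<..1}"

lemma space_policy_space: "space (policy_space m) = {1..m} \<times> {0<..1}"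
  by (simp add: space_pair_measure space_restrict_space)

text \<open>The first coordinate is countable, so measurable sections suffice; these are continuous,
  being finite sums of minima of continuous functions of \<open>\<rho>\<close>.\<close>

lemma measurable_coverage: "(\<lambda>z. coverage k n G z j) \<in> borel_measurable (policy_space m)"
proof (rule measurable_pair_measure_countable1)
  fix J assume "J \<in> {1..m}"
  have "continuous_on UNIV (\<lambda>\<rho>. coverage k n G (J, \<rho>) j)"
    unfolding coverage_def prod.case y_arr.simps
    by (intro continuous_intros continuous_on_x_arr)
  then have "(\<lambda>\<rho>. coverage k n G (J, \<rho>) j) \<in> borel_measurable borel"
    by (rule borel_measurable_continuous_onI)
  then show "(\<lambda>\<rho>. coverage k n G (J, \<rho>) j) \<in> borel_measurable (restrict_space borel {0<..1})"
    by (rule measurable_restrict_space1)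
qed auto

section \<open>Instances versus type distributions\<close>

lemma is_type_dist_cdf:
  assumes I: "is_instance n m r p" and c: "is_cdf_of n m p G"
  shows "is_type_dist n m G"
  using I c unfolding is_instance_def is_type_dist_def is_cdf_of_def by auto

lemma is_cdf_of_increments:
  assumes G: "is_type_dist n m G"
  shows "is_cdf_of n m (\<lambda>i j. G i j - G i (j - 1)) G"
  unfolding is_cdf_of_def
proof (intro ballI allI impI)
  fix i j assume i: "i \<in> {1..n}" and "j \<le> m"
  have "(\<Sum>a=1..j. G i a - G i (a - 1)) = G i j - G i 0"
    by (induction j) auto
  then show "G i j = (\<Sum>a=1..j. G i a - G i (a - 1))"
    using G i by (auto simp: is_type_dist_def)
qed

text \<open>This is the origin of the minimum in the inner program. If \<open>j\<close> is better
  than the threshold, all types up to \<open>j\<close> are accepted, with mass \<open>G i j\<close>;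
  otherwise every accepted type counts, with mass \<open>accept_prob G J \<rho> i\<close>.
  Monotonicity of \<open>G\<close> tells which of the two is smaller.\<close>

lemma sum_accept_prob:
  assumes G: "is_type_dist n m G" "i \<in> {1..n}" and c: "is_cdf_of n m p G"
    and J: "J \<in> {1..m}" and \<rho>: "0 \<le> \<rho>" "\<rho> \<le> 1" and j: "j \<le> m"
  shows "(\<Sum>a=1..j. p i a * (of_bool (a < J) + \<rho> * of_bool (a = J))) =
         min (accept_prob G J \<rho> i) (G i j)"
proof (cases "j < J")
  case True
  have "(\<Sum>a=1..j. p i a * (of_bool (a < J) + \<rho> * of_bool (a = J))) = (\<Sum>a=1..j. p i a)"
    using True by (intro sum.cong) auto
  also have "\<dots> = G i j" using c G j by (auto simp: is_cdf_of_def)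
  moreover have "G i j \<le> G i (J - 1)"
    using True J is_type_dist_mono[OF G, of j "J - 1"] by auto
  ultimately show ?thesis using accept_prob_bounds[OF G J \<rho>] by auto
next
  case False
  have "(\<Sum>a=1..j. p i a * (of_bool (a < J) + \<rho> * of_bool (a = J))) =
        (\<Sum>a=1..J. p i a * (of_bool (a < J) + \<rho> * of_bool (a = J)))"
    using False by (intro sum.mono_neutral_right) auto
  also have "\<dots> = (\<Sum>a=1..J - 1. p i a) + \<rho> * p i J"
  proof -
    have *: "{1..J} = insert J {1..J - 1}" "J \<notin> {1..J - 1}" using J by auto
    have "(\<Sum>a=1..J - 1. p i a * (of_bool (a < J) + \<rho> * of_bool (a = J))) = (\<Sum>a=1..J - 1. p i a)"
      using J by (intro sum.cong) auto
    then show ?thesis unfolding *(1) by (subst sum.insert) (use *(2) in auto)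
  qed
  also have "\<dots> = accept_prob G J \<rho> i"
  proof -
    have "J - 1 \<le> m" "J \<le> m" using J by auto
    then have "G i (J - 1) = (\<Sum>a=1..J - 1. p i a)" "G i J = (\<Sum>a=1..J. p i a)"
      using c G(2) unfolding is_cdf_of_def by blast+
    moreover have "(\<Sum>a=1..J. p i a) = (\<Sum>a=1..J - 1. p i a) + p i J"
      using J by (cases J) auto
    ultimately show ?thesis by (simp add: accept_prob_def algebra_simps)
  qed
  moreover have "G i J \<le> G i j" using False is_type_dist_mono[OF G, of J j] j by auto
  ultimately show ?thesis using accept_prob_bounds[OF G J \<rho>] by auto
qed

section \<open>The random run of a policy, agent by agent\<close>

text \<open>The law behind \<open>policy_value\<close>, with the number of agents free so that
  induction can run over prefixes of the arrival sequence.\<close>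

definition run_pmf :: "nat \<Rightarrow> nat \<Rightarrow> (nat \<Rightarrow> nat \<Rightarrow> real) \<Rightarrow> real \<Rightarrow>
    ((nat \<Rightarrow> nat) \<times> (nat \<Rightarrow> bool)) pmf" where
  "run_pmf n m p \<rho> =
     pair_pmf (types_pmf n m p) (Pi_pmf {1..n} False (\<lambda>_. bernoulli_pmf \<rho>))"

lemma expectation_type_pmf:
  fixes f :: "nat \<Rightarrow> real"
  assumes I: "is_instance n m r p" and i: "i \<in> {1..n}"
  shows "measure_pmf.expectation (type_pmf m p i) f = (\<Sum>a=1..m. p i a * f a)"
proof -
  have "measure_pmf.expectation (type_pmf m p i) f = (\<Sum>a=1..m. f a * pmf (type_pmf m p i) a)"
    by (rule integral_measure_pmf_real)
      (auto simp: pmf_type_pmf[OF I i] set_pmf_eq split: if_splits)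
  then show ?thesis by (simp add: pmf_type_pmf[OF I i] mult.commute)
qed

lemma set_type_pmf_subset:
  assumes "is_instance n m r p" "i \<in> {1..n}"
  shows "set_pmf (type_pmf m p i) \<subseteq> {1..m}"
  using pmf_type_pmf[OF assms] by (auto simp: set_pmf_eq split: if_splits)

lemma finite_set_types_pmf:
  assumes I: "is_instance n m r p" and i: "i \<le> n"
  shows "finite (set_pmf (types_pmf i m p))"
  unfolding types_pmf_def
proof (rule finite_subset[OF set_Pi_pmf_subset'])
  have "finite (set_pmf (type_pmf m p s))" if "s \<in> {1..i}" for s
    using set_type_pmf_subset[OF I, of s] that i by (auto intro: finite_subset)
  then show "finite (PiE_dflt {1..i} 0 (set_pmf \<circ> type_pmf m p))"
    by (intro finite_PiE_dflt) auto
qed simp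

lemma finite_set_run_pmf:
  assumes I: "is_instance n m r p" and i: "i \<le> n"
  shows "finite (set_pmf (run_pmf i m p \<rho>))"
proof -
  have "finite (set_pmf (Pi_pmf {1..i} False (\<lambda>_. bernoulli_pmf \<rho>)))"
    by (rule finite_subset[OF set_Pi_pmf_subset'])
      (auto intro!: finite_PiE_dflt finite_set_bool_pmf)
  then show ?thesis
    using finite_set_types_pmf[OF assms] by (simp add: run_pmf_def)
qed

text \<open>Both product laws gain one factor, and independent draws commute, so the new type and
  the new coin can be drawn last.\<close>

lemma run_pmf_Suc:
  "run_pmf (Suc i) m p \<rho> =
     bind_pmf (run_pmf i m p \<rho>) (\<lambda>(t, c).
       bind_pmf (pair_pmf (type_pmf m p (Suc i)) (bernoulli_pmf \<rho>)) (\<lambda>(a, b).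
         return_pmf (t(Suc i := a), c(Suc i := b))))"
proof -
  have *: "{1..Suc i} = insert (Suc i) {1..i}" by auto
  show ?thesis
    unfolding run_pmf_def types_pmf_def *
    apply (subst (1 2) Pi_pmf_insert')
    apply (simp_all add: pair_pmf_def bind_assoc_pmf bind_return_pmf)
    apply (subst bind_commute_pmf)
    apply (subst bind_commute_pmf[of "Pi_pmf {Suc 0..i} False (\<lambda>_. bernoulli_pmf \<rho>)"])
    apply (rule bind_pmf_cong[OF refl])+
    apply (rule bind_commute_pmf)
    done
qed

text \<open>\<open>F\<close> and \<open>H\<close> see only the past and \<open>w\<close> only the
  fresh draw, so the expectation of \<open>H * w\<close> splits. Both quantities tracked below, the
  free slots and the accumulated value, change in this form.\<close>

lemma expectation_run_pmf_Suc:
  fixes f F H :: "(nat \<Rightarrow> nat) \<times> (nat \<Rightarrow> bool) \<Rightarrow> real"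
  assumes I: "is_instance n m r p" and i: "Suc i \<le> n" and \<rho>: "0 \<le> \<rho>" "\<rho> \<le> 1"
    and f: "\<And>t c a b. f (t(Suc i := a), c(Suc i := b)) = F (t, c) + H (t, c) * w a b"
  shows "measure_pmf.expectation (run_pmf (Suc i) m p \<rho>) f =
    measure_pmf.expectation (run_pmf i m p \<rho>) F + measure_pmf.expectation (run_pmf i m p \<rho>) H *
      (\<Sum>a=1..m. p (Suc i) a * (\<rho> * w a True + (1 - \<rho>) * w a False))"
proof -
  let ?T = "type_pmf m p (Suc i)"
  have Si: "Suc i \<in> {1..n}" using i by auto
  have fin: "finite (set_pmf (run_pmf i m p \<rho>))"
    using finite_set_run_pmf[OF I, of i] i by auto
  have finT: "finite (set_pmf ?T)"
    using set_type_pmf_subset[OF I Si] by (rule finite_subset) auto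
  have finB: "finite (set_pmf (pair_pmf ?T (bernoulli_pmf \<rho>)))"
    using finT finite_set_bool_pmf by simp
  have wexp: "measure_pmf.expectation (pair_pmf ?T (bernoulli_pmf \<rho>)) (\<lambda>(a, b). w a b) =
      (\<Sum>a=1..m. p (Suc i) a * (\<rho> * w a True + (1 - \<rho>) * w a False))"
  proof -
    have "measure_pmf.expectation (bind_pmf (bernoulli_pmf \<rho>) (\<lambda>b. return_pmf (a, b))) (\<lambda>(a, b). w a b) =
        \<rho> * w a True + (1 - \<rho>) * w a False" for a
      using \<rho> by (subst expectation_bind_pmf_finite[OF finite_set_bool_pmf]) auto
    then show ?thesis
      unfolding pair_pmf_def using finT
      by (subst expectation_bind_pmf_finite) (auto simp: expectation_type_pmf[OF I Si] finite_set_bool_pmf)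
  qed
  have int: "integrable (measure_pmf (run_pmf i m p \<rho>)) g" for g :: "_ \<Rightarrow> real"
    using fin by (rule integrable_measure_pmf_finite)
  have "measure_pmf.expectation (run_pmf (Suc i) m p \<rho>) f =
      measure_pmf.expectation (run_pmf i m p \<rho>) (\<lambda>(t, c).
        measure_pmf.expectation (pair_pmf ?T (bernoulli_pmf \<rho>)) (\<lambda>(a, b).
          F (t, c) + H (t, c) * w a b))"
    unfolding run_pmf_Suc using fin finB
    by (subst expectation_bind_pmf_finite)
      (auto simp: expectation_bind_pmf_finite f case_prod_unfold intro!: Bochner_Integration.integral_cong)
  also have "\<dots> = measure_pmf.expectation (run_pmf i m p \<rho>) (\<lambda>z. F z + H z *
      (\<Sum>a=1..m. p (Suc i) a * (\<rho> * w a True + (1 - \<rho>) * w a False)))"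
    unfolding wexp[symmetric]
    by (intro Bochner_Integration.integral_cong refl)
       (auto simp: case_prod_unfold integrable_measure_pmf_finite[OF finB])
  finally show ?thesis using int by simp
qed

section \<open>Free slots and the value of a policy\<close>

lemma accepted_subset: "accepted k J t c i \<subseteq> {1..i}"
  by (induction i) (auto simp: subset_iff le_Suc_eq)

lemma finite_accepted: "finite (accepted k J t c i)"
  using accepted_subset by (rule finite_subset) simp

lemma Suc_notin_accepted: "Suc i \<notin> accepted k J t c i"
  using accepted_subset by fastforce

lemma accepted_upd: "i < s \<Longrightarrow> accepted k J (t(s := a)) (c(s := b)) i = accepted k J t c i"
  by (induction i) auto

text \<open>The array entry is the probability of exactly \<open>l\<close> free slots on arrival of
  agent \<open>Suc i\<close>: acceptance moves level \<open>Suc l\<close> to \<open>l\<close>. Level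
  0 is excluded, because the recursion would keep draining it while the process stops there.\<close>

lemma expectation_free_slots:
  assumes I: "is_instance n m r p" and c: "is_cdf_of n m p G"
    and J: "J \<in> {1..m}" and \<rho>: "0 \<le> \<rho>" "\<rho> \<le> 1"
    and i: "i \<le> n" and l: "l \<in> {1..k}"
  shows "measure_pmf.expectation (run_pmf i m p \<rho>)
           (\<lambda>(t, c). of_bool (card (accepted k J t c i) + l = k)) = x_arr k G J \<rho> (Suc i) l"
  using i l
proof (induction i arbitrary: l)
  case 0
  then show ?case by (auto simp: case_prod_unfold)
next
  case (Suc i)
  note G = is_type_dist_cdf[OF I c]
  let ?S = "\<lambda>l (t, c). of_bool (card (accepted k J t c i) + l = k) :: real"
  have fin: "finite (set_pmf (run_pmf i m p \<rho>))"
    using finite_set_run_pmf[OF I, of i] Suc.prems by auto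
  have int: "integrable (measure_pmf (run_pmf i m p \<rho>)) g" for g :: "_ \<Rightarrow> real"
    using fin by (rule integrable_measure_pmf_finite)
  \<comment> \<open>Acceptance replaces the indicator of \<open>l\<close> free slots by that of
    \<open>Suc l\<close>; hence \<open>F = ?S l\<close> and \<open>H = ?S (Suc l) - ?S l\<close>.
    When no slot is left both indicators are 0, as \<open>l \<ge> 1\<close>.\<close>
  have "measure_pmf.expectation (run_pmf (Suc i) m p \<rho>)
           (\<lambda>(t, c). of_bool (card (accepted k J t c (Suc i)) + l = k)) =
      measure_pmf.expectation (run_pmf i m p \<rho>) (?S l) +
      measure_pmf.expectation (run_pmf i m p \<rho>) (\<lambda>z. ?S (Suc l) z - ?S l z) *
      (\<Sum>a=1..m. p (Suc i) a *
         (\<rho> * of_bool (a < J \<or> a = J \<and> True) + (1 - \<rho>) * of_bool (a < J \<or> a = J \<and> False)))"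
    using Suc.prems
    by (intro expectation_run_pmf_Suc[OF I _ \<rho>])
       (auto simp: accepted_upd finite_accepted Suc_notin_accepted)
  also have "(\<Sum>a=1..m. p (Suc i) a *
         (\<rho> * of_bool (a < J \<or> a = J \<and> True) + (1 - \<rho>) * of_bool (a < J \<or> a = J \<and> False))) =
       (\<Sum>a=1..m. p (Suc i) a * (of_bool (a < J) + \<rho> * of_bool (a = J)))"
    by (intro sum.cong refl) auto
  \<comment> \<open>The case \<open>j = m\<close>: there \<open>G\<close> is 1, so the minimum is
    the acceptance probability.\<close>
  also have "\<dots> = accept_prob G J \<rho> (Suc i)"
    using accept_prob_mem_Icc[OF G _ J \<rho>, of "Suc i"] Suc.prems G
    by (subst sum_accept_prob[OF G _ c J \<rho>]) (auto simp: is_type_dist_def)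
  also have "measure_pmf.expectation (run_pmf i m p \<rho>) (?S l) = x_arr k G J \<rho> (Suc i) l"
    using Suc by auto
  also have "measure_pmf.expectation (run_pmf i m p \<rho>) (\<lambda>z. ?S (Suc l) z - ?S l z) =
      measure_pmf.expectation (run_pmf i m p \<rho>) (?S (Suc l)) - x_arr k G J \<rho> (Suc i) l"
    using Suc int by (subst Bochner_Integration.integral_diff) auto
  \<comment> \<open>More than \<open>k\<close> free slots are impossible, which matches the boundary
    case of \<open>x_arr\<close>.\<close>
  also have "measure_pmf.expectation (run_pmf i m p \<rho>) (?S (Suc l)) =
      (if l = k then 0 else x_arr k G J \<rho> (Suc i) (Suc l))"
    using Suc.IH[of "Suc l"] Suc.prems by (auto simp: case_prod_unfold)
  finally show ?case
    by (auto simp: y_arr_eq algebra_simps simp del: y_arr.simps accepted.simps)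
qed

text \<open>Whether a slot is free depends on earlier agents only, so each agent contributes the
  product of that probability and the mean of the value it would bring if a slot were free.\<close>

lemma expectation_accepted_sum:
  assumes I: "is_instance n m r p" and c: "is_cdf_of n m p G"
    and J: "J \<in> {1..m}" and \<rho>: "0 \<le> \<rho>" "\<rho> \<le> 1" and i: "i \<le> n"
  shows "measure_pmf.expectation (run_pmf i m p \<rho>)
           (\<lambda>(t, c). \<Sum>s\<in>accepted k J t c i. r (t s)) =
         (\<Sum>s=1..i. (\<Sum>l=1..k. x_arr k G J \<rho> s l) *
            (\<Sum>a=1..m. p s a * (of_bool (a < J) + \<rho> * of_bool (a = J)) * r a))"
  using i
proof (induction i)
  case 0
  then show ?case by (auto simp: case_prod_unfold)
next
  case (Suc i)
  have fin: "finite (set_pmf (run_pmf i m p \<rho>))"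
    using finite_set_run_pmf[OF I, of i] Suc.prems by auto
  have int: "integrable (measure_pmf (run_pmf i m p \<rho>)) g" for g :: "_ \<Rightarrow> real"
    using fin by (rule integrable_measure_pmf_finite)
  have slots: "of_bool (N < k) = (\<Sum>l=1..k. of_bool (N + l = k) :: real)" for N
  proof (cases "N < k")
    case True
    have "(\<Sum>l=1..k. of_bool (N + l = k) :: real) = (\<Sum>l=1..k. if l = k - N then 1 else 0)"
      using True by (intro sum.cong) auto
    with True show ?thesis by simp
  qed simp
  have free: "measure_pmf.expectation (run_pmf i m p \<rho>)
      (\<lambda>(t, c). of_bool (card (accepted k J t c i) < k)) = (\<Sum>l=1..k. x_arr k G J \<rho> (Suc i) l)"
  proof -
    have "measure_pmf.expectation (run_pmf i m p \<rho>)
        (\<lambda>(t, c). of_bool (card (accepted k J t c i) < k) :: real) =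
      (\<Sum>l=1..k. measure_pmf.expectation (run_pmf i m p \<rho>)
        (\<lambda>(t, c). of_bool (card (accepted k J t c i) + l = k)))"
      unfolding slots case_prod_unfold by (intro Bochner_Integration.integral_sum int)
    then show ?thesis
      using expectation_free_slots[OF I c J \<rho>, of i] Suc.prems by simp
  qed
  have upd: "(\<Sum>s\<in>accepted k J t c i. r (if s = Suc i then a else t s)) =
      (\<Sum>s\<in>accepted k J t c i. r (t s))" for t c a
    using Suc_notin_accepted[of i k J t c] by (intro sum.cong) auto
  have "measure_pmf.expectation (run_pmf (Suc i) m p \<rho>)
           (\<lambda>(t, c). \<Sum>s\<in>accepted k J t c (Suc i). r (t s)) =
      measure_pmf.expectation (run_pmf i m p \<rho>) (\<lambda>(t, c). \<Sum>s\<in>accepted k J t c i. r (t s)) +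
      measure_pmf.expectation (run_pmf i m p \<rho>) (\<lambda>(t, c). of_bool (card (accepted k J t c i) < k)) *
      (\<Sum>a=1..m. p (Suc i) a *
         (\<rho> * (of_bool (a < J \<or> a = J \<and> True) * r a) +
          (1 - \<rho>) * (of_bool (a < J \<or> a = J \<and> False) * r a)))"
    using Suc.prems
    by (intro expectation_run_pmf_Suc[OF I _ \<rho>])
       (auto simp: accepted_upd finite_accepted Suc_notin_accepted upd)
  also have "(\<Sum>a=1..m. p (Suc i) a *
         (\<rho> * (of_bool (a < J \<or> a = J \<and> True) * r a) +
          (1 - \<rho>) * (of_bool (a < J \<or> a = J \<and> False) * r a))) =
       (\<Sum>a=1..m. p (Suc i) a * (of_bool (a < J) + \<rho> * of_bool (a = J)) * r a)"
    by (intro sum.cong refl) (auto simp: algebra_simps)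
  finally show ?case using Suc free by simp
qed

text \<open>Abel summation for each agent separately, followed by an exchange of the sums over
  agents and levels.\<close>

lemma policy_value_eq_coverage:
  assumes I: "is_instance n m r p" and c: "is_cdf_of n m p G"
    and J: "J \<in> {1..m}" and \<rho>: "0 \<le> \<rho>" "\<rho> \<le> 1"
  shows "policy_value k n m r p J \<rho> = (\<Sum>j=1..m. drop_val m r j * coverage k n G (J, \<rho>) j)"
proof -
  note G = is_type_dist_cdf[OF I c]
  have "policy_value k n m r p J \<rho> =
      (\<Sum>s=1..n. (\<Sum>l=1..k. x_arr k G J \<rho> s l) *
         (\<Sum>a=1..m. p s a * (of_bool (a < J) + \<rho> * of_bool (a = J)) * r a))"
    unfolding policy_value_def run_pmf_def[symmetric]
    by (rule expectation_accepted_sum[OF I c J \<rho> order_refl])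
  also have "\<dots> = (\<Sum>s=1..n. (\<Sum>l=1..k. x_arr k G J \<rho> s l) *
      (\<Sum>j=1..m. drop_val m r j * min (accept_prob G J \<rho> s) (G s j)))"
  proof (rule sum.cong[OF refl])
    fix s assume s: "s \<in> {1..n}"
    have "(\<Sum>a=1..m. p s a * (of_bool (a < J) + \<rho> * of_bool (a = J)) * r a) =
        (\<Sum>j=1..m. drop_val m r j * min (accept_prob G J \<rho> s) (G s j))"
      by (subst sum_mult_drop_val) (use sum_accept_prob[OF G s c J \<rho>] in simp)
    then show "(\<Sum>l=1..k. x_arr k G J \<rho> s l) *
        (\<Sum>a=1..m. p s a * (of_bool (a < J) + \<rho> * of_bool (a = J)) * r a) =
      (\<Sum>l=1..k. x_arr k G J \<rho> s l) *
        (\<Sum>j=1..m. drop_val m r j * min (accept_prob G J \<rho> s) (G s j))" by (rule arg_cong)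
  qed
  also have "\<dots> = (\<Sum>s=1..n. \<Sum>j=1..m. drop_val m r j *
      ((\<Sum>l=1..k. x_arr k G J \<rho> s l) * min (accept_prob G J \<rho> s) (G s j)))"
    by (simp only: sum_distrib_left mult.left_commute)
  also have "\<dots> = (\<Sum>j=1..m. drop_val m r j * coverage k n G (J, \<rho>) j)"
    by (subst sum.swap) (simp only: coverage_eq_sum[OF G J \<rho>] sum_distrib_left)
  finally show ?thesis .
qed

subsection \<open>The prophet and the ex-ante relaxation\<close>

lemma sum_drop_val_count:
  assumes "finite S" "\<And>i. i \<in> S \<Longrightarrow> t i \<in> {1..m}"
  shows "(\<Sum>i\<in>S. r (t i)) = (\<Sum>j=1..m. drop_val m r j * real (card {i\<in>S. t i \<le> j}))"
proof -
  have "(\<Sum>i\<in>S. r (t i)) = (\<Sum>i\<in>S. \<Sum>j=1..m. drop_val m r j * of_bool (t i \<le> j))"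
  proof (intro sum.cong refl)
    fix i assume "i \<in> S"
    with assms(2) have ti: "t i \<in> {1..m}" by simp
    then have "r (t i) = (\<Sum>j=t i..m. drop_val m r j)" by (simp add: sum_drop_val)
    also have "\<dots> = (\<Sum>j=1..m. drop_val m r j * of_bool (t i \<le> j))"
      using ti by (intro sum.mono_neutral_cong_left) auto
    finally show "r (t i) = (\<Sum>j=1..m. drop_val m r j * of_bool (t i \<le> j))" .
  qed
  also have "\<dots> = (\<Sum>j=1..m. drop_val m r j * (\<Sum>i\<in>S. of_bool (t i \<le> j)))"
    by (subst sum.swap) (simp add: sum_distrib_left)
  finally show ?thesis
    using assms(1) by (simp add: Int_def)
qed

text \<open>Taking elements level by level until \<open>k\<close> are chosen is optimal for all
  levels at once. In the induction step the set is either full already or equal to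
  \<open>A m\<close>, and then it is enlarged within \<open>A (Suc m)\<close>.\<close>

lemma ex_greedy_subset:
  fixes A :: "nat \<Rightarrow> 'a set"
  assumes "\<And>i j. i \<le> j \<Longrightarrow> j \<le> m \<Longrightarrow> A i \<subseteq> A j" "finite (A m)"
  shows "\<exists>S\<subseteq>A m. card S \<le> k \<and> (\<forall>j\<le>m. card (S \<inter> A j) = min k (card (A j)))"
  using assms
proof (induction m)
  case 0
  obtain S where "S \<subseteq> A 0" "card S = min k (card (A 0))"
    by (meson obtain_subset_with_card_n min.cobounded2)
  then show ?case by (intro exI[of _ S]) (auto simp: Int_absorb2)
next
  case (Suc m)
  have sub: "A m \<subseteq> A (Suc m)" using Suc.prems(1) by simp
  then have finm: "finite (A m)" using Suc.prems(2) by (rule finite_subset)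
  obtain S where S: "S \<subseteq> A m" "card S \<le> k" "\<And>j. j \<le> m \<Longrightarrow> card (S \<inter> A j) = min k (card (A j))"
    using Suc.IH Suc.prems(1) finm by (metis le_SucI)
  have cS: "card S = min k (card (A m))"
    using S(3)[of m] S(1) by (simp add: Int_absorb2)
  have le: "card (A m) \<le> card (A (Suc m))"
    using sub Suc.prems(2) by (rule card_mono[rotated])
  show ?case
  proof (cases "k \<le> card (A m)")
    case True
    then have "card (S \<inter> A (Suc m)) = min k (card (A (Suc m)))"
      using cS S(1) sub le by (simp add: Int_absorb2 subset_trans)
    then show ?thesis
      using S sub by (intro exI[of _ S]) (auto simp: le_Suc_eq)
  next
    case False
    with cS S(1) finm have SA: "S = A m" by (intro card_subset_eq) auto
    have "card (A m) \<le> min k (card (A (Suc m)))" using False le by simp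
    from exists_subset_between[OF this _ sub Suc.prems(2)]
    obtain T where T: "A m \<subseteq> T" "T \<subseteq> A (Suc m)" "card T = min k (card (A (Suc m)))" by auto
    have "card (T \<inter> A j) = min k (card (A j))" if "j \<le> Suc m" for j
    proof (cases "j = Suc m")
      case True
      then show ?thesis using T by (simp add: Int_absorb2)
    next
      case False
      then have "A j \<subseteq> A m" using Suc.prems(1)[of j m] that by auto
      then have "T \<inter> A j = S \<inter> A j" using T(1) SA by blast
      then show ?thesis using S(3) False that by simp
    qed
    then show ?thesis using T by (intro exI[of _ T]) auto
  qed
qed

lemma drop_val_nonneg:
  assumes "is_instance n m r p" "j \<in> {1..m}"
  shows "0 \<le> drop_val m r j"
  using assms by (auto simp: is_instance_def drop_val_def)

text \<open>Each level count of a set obeys its own bound, and the drops are nonnegative; the greedy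
  set attains all the bounds simultaneously.\<close>

lemma Max_subset_sum:
  assumes I: "is_instance n m r p" and t: "\<And>i. i \<in> {1..n} \<Longrightarrow> t i \<in> {1..m}"
  shows "Max ((\<lambda>S. \<Sum>i\<in>S. r (t i)) ` {S. S \<subseteq> {1..n} \<and> card S \<le> k}) =
    (\<Sum>j=1..m. drop_val m r j * real (min k (card {i\<in>{1..n}. t i \<le> j})))"
proof (rule Max_eqI)
  show "finite ((\<lambda>S. \<Sum>i\<in>S. r (t i)) ` {S. S \<subseteq> {1..n} \<and> card S \<le> k})" by simp
next
  fix y assume "y \<in> (\<lambda>S. \<Sum>i\<in>S. r (t i)) ` {S. S \<subseteq> {1..n} \<and> card S \<le> k}"
  then obtain S where S: "S \<subseteq> {1..n}" "card S \<le> k" and y: "y = (\<Sum>i\<in>S. r (t i))" by auto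
  have fin: "finite S" using S(1) by (rule finite_subset) simp
  have "card {i\<in>S. t i \<le> j} \<le> min k (card {i\<in>{1..n}. t i \<le> j})" for j
  proof -
    have "card {i\<in>S. t i \<le> j} \<le> card S" using fin by (intro card_mono) auto
    moreover have "card {i\<in>S. t i \<le> j} \<le> card {i\<in>{1..n}. t i \<le> j}"
      using S by (intro card_mono) auto
    ultimately show ?thesis using S by simp
  qed
  moreover have "y = (\<Sum>j=1..m. drop_val m r j * real (card {i\<in>S. t i \<le> j}))"
    unfolding y using fin S t by (intro sum_drop_val_count) auto
  ultimately show "y \<le> (\<Sum>j=1..m. drop_val m r j * real (min k (card {i\<in>{1..n}. t i \<le> j})))"
    using drop_val_nonneg[OF I] by (auto intro!: sum_mono mult_left_mono simp del: of_nat_min)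
next
  let ?A = "\<lambda>j. {i\<in>{1..n}. t i \<le> j}"
  have "\<exists>S\<subseteq>?A m. card S \<le> k \<and> (\<forall>j\<le>m. card (S \<inter> ?A j) = min k (card (?A j)))"
    by (rule ex_greedy_subset) auto
  then obtain S where S: "S \<subseteq> ?A m" "card S \<le> k"
    "\<And>j. j \<le> m \<Longrightarrow> card (S \<inter> ?A j) = min k (card (?A j))" by blast
  have fin: "finite S" using S(1) by (rule finite_subset) simp
  have "(\<Sum>i\<in>S. r (t i)) = (\<Sum>j=1..m. drop_val m r j * real (card {i\<in>S. t i \<le> j}))"
    using fin S t by (intro sum_drop_val_count) auto
  also have "\<dots> = (\<Sum>j=1..m. drop_val m r j * real (min k (card (?A j))))"
  proof (intro sum.cong refl)
    fix j assume "j \<in> {1..m}"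
    moreover have "S \<inter> ?A j = {i\<in>S. t i \<le> j}" using S(1) by auto
    ultimately show "drop_val m r j * real (card {i\<in>S. t i \<le> j}) =
        drop_val m r j * real (min k (card (?A j)))" using S(3)[of j] by simp
  qed
  finally show "(\<Sum>j=1..m. drop_val m r j * real (min k (card (?A j))))
      \<in> (\<lambda>S. \<Sum>i\<in>S. r (t i)) ` {S. S \<subseteq> {1..n} \<and> card S \<le> k}"
    using S by (intro image_eqI[of _ _ S]) auto
qed

text \<open>The conjunct \<open>1 \<le> a\<close> sends the default type 0 of
  \<open>types_pmf\<close> to the default \<open>False\<close> of the coins, so that the product
  laws correspond. It excludes no type that is drawn.\<close>

lemma map_type_pmf_threshold:
  assumes I: "is_instance n m r p" and c: "is_cdf_of n m p G" and i: "i \<in> {1..n}" and j: "j \<le> m"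
  shows "map_pmf (\<lambda>a. 1 \<le> a \<and> a \<le> j) (type_pmf m p i) = bernoulli_pmf (G i j)"
proof -
  have g: "0 \<le> G i j" "G i j \<le> 1"
    using is_type_dist_mem_Icc[OF is_type_dist_cdf[OF I c] i j] by auto
  have "pmf (map_pmf (\<lambda>a. 1 \<le> a \<and> a \<le> j) (type_pmf m p i)) True =
      measure_pmf.prob (type_pmf m p i) {1..j}"
  proof -
    have "(\<lambda>a. 1 \<le> a \<and> a \<le> j) -` {True} = {1..j}"
      unfolding vimage_def atLeastAtMost_def atLeast_def atMost_def by blast
    then show ?thesis unfolding pmf_map by (rule arg_cong)
  qed
  also have "\<dots> = (\<Sum>a=1..j. pmf (type_pmf m p i) a)"
    by (simp add: measure_measure_pmf_finite)
  also have "\<dots> = (\<Sum>a=1..j. p i a)"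
    using j by (intro sum.cong) (auto simp: pmf_type_pmf[OF I i])
  also have "\<dots> = G i j" using c i j by (simp add: is_cdf_of_def)
  finally have T: "pmf (map_pmf (\<lambda>a. 1 \<le> a \<and> a \<le> j) (type_pmf m p i)) True = G i j" .
  show ?thesis
  proof (rule pmf_eqI)
    fix b
    show "pmf (map_pmf (\<lambda>a. 1 \<le> a \<and> a \<le> j) (type_pmf m p i)) b = pmf (bernoulli_pmf (G i j)) b"
      using T g by (cases b) (simp_all add: pmf_False_conv_True)
  qed
qed

lemma Q_Proph_eq_expectation:
  assumes I: "is_instance n m r p" and c: "is_cdf_of n m p G" and j: "j \<le> m"
  shows "Q_Proph k n G j = measure_pmf.expectation (types_pmf n m p)
    (\<lambda>t. real (min k (card {i\<in>{1..n}. 1 \<le> t i \<and> t i \<le> j})))"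
proof -
  have "Pi_pmf {1..n} False (\<lambda>i. bernoulli_pmf (G i j)) =
      Pi_pmf {1..n} False (\<lambda>i. map_pmf (\<lambda>a. 1 \<le> a \<and> a \<le> j) (type_pmf m p i))"
    using map_type_pmf_threshold[OF I c _ j] by (intro Pi_pmf_cong) auto
  also have "\<dots> = map_pmf (\<lambda>t. (\<lambda>a. 1 \<le> a \<and> a \<le> j) \<circ> t) (types_pmf n m p)"
    unfolding types_pmf_def by (rule Pi_pmf_map) auto
  finally show ?thesis
    unfolding Q_Proph_def
    by (simp add: Int_def min.commute of_nat_min conj_assoc)
qed

lemma Proph_eq:
  assumes I: "is_instance n m r p" and c: "is_cdf_of n m p G"
  shows "Proph k n m r p = (\<Sum>j=1..m. drop_val m r j * Q_Proph k n G j)"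
proof -
  have int: "integrable (measure_pmf (types_pmf n m p)) g" for g :: "_ \<Rightarrow> real"
    by (rule integrable_measure_pmf_finite[OF finite_set_types_pmf[OF I order_refl]])
  have "Proph k n m r p = measure_pmf.expectation (types_pmf n m p) (\<lambda>t.
      \<Sum>j=1..m. drop_val m r j * real (min k (card {i\<in>{1..n}. 1 \<le> t i \<and> t i \<le> j})))"
    unfolding Proph_def
  proof (intro integral_cong_AE, simp, simp, unfold AE_measure_pmf_iff, intro ballI)
    fix t assume "t \<in> set_pmf (types_pmf n m p)"
    then have t: "t i \<in> {1..m}" if "i \<in> {1..n}" for i
      using set_Pi_pmf_subset'[of "{1..n}" 0 "type_pmf m p"] set_type_pmf_subset[OF I that] that
      unfolding types_pmf_def by (fastforce simp: PiE_dflt_def)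
    have "{i\<in>{1..n}. t i \<le> j} = {i\<in>{1..n}. 1 \<le> t i \<and> t i \<le> j}" for j
      using t by auto
    then show "Max ((\<lambda>S. \<Sum>i\<in>S. r (t i)) ` {S. S \<subseteq> {1..n} \<and> card S \<le> k}) =
      (\<Sum>j=1..m. drop_val m r j * real (min k (card {i\<in>{1..n}. 1 \<le> t i \<and> t i \<le> j})))"
      using Max_subset_sum[OF I t] by simp
  qed
  also have "\<dots> = (\<Sum>j=1..m. drop_val m r j * Q_Proph k n G j)"
    using int by (subst Bochner_Integration.integral_sum) (auto simp: Q_Proph_eq_expectation[OF I c])
  finally show ?thesis .
qed

text \<open>Filling the capacity from the best type on is optimal: by Abel summation only the
  cumulative allocations matter, and these are bounded by both the supply and
  \<open>k\<close>.\<close>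

lemma ExAnte_eq:
  assumes I: "is_instance n m r p" and c: "is_cdf_of n m p G"
  shows "ExAnte k n m r p = (\<Sum>j=1..m. drop_val m r j * Q_ExAnte k n G j)"
  unfolding ExAnte_def
proof (rule cSup_eq_maximum)
  \<comment> \<open>The cumulative greedy allocation. It is 0 at 0, so its increments telescope;
    they are the maximiser.\<close>
  define q where "q j = min (\<Sum>i=1..n. \<Sum>a=1..j. p i a) (real k)" for j
  have q: "q j = Q_ExAnte k n G j" if "j \<le> m" for j
    using c that by (simp add: q_def Q_ExAnte_def is_cdf_of_def)
  have p0: "0 \<le> p i a" if "i \<in> {1..n}" "a \<in> {1..m}" for i a
    using I that by (simp add: is_instance_def)
  have step: "q j - q (j - 1) \<in> {0..\<Sum>i=1..n. p i j}" if j: "j \<in> {1..m}" for j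
  proof -
    obtain j' where j': "j = Suc j'" using j by (cases j) auto
    have "0 \<le> (\<Sum>i=1..n. p i j)" using p0 j by (intro sum_nonneg) auto
    then show ?thesis by (auto simp: q_def j' sum.distrib min_def)
  qed
  have tele: "(\<Sum>a=1..j. q a - q (a - 1)) = q j" for j
    by (induction j) (auto simp: q_def)
  let ?P = "\<lambda>a :: nat \<Rightarrow> real. (\<Sum>j=1..m. a j) \<le> real k \<and>
            (\<forall>j\<in>{1..m}. 0 \<le> a j \<and> a j \<le> (\<Sum>i=1..n. p i j))"
  have "(\<Sum>j=1..m. r j * (q j - q (j - 1))) = (\<Sum>j=1..m. drop_val m r j * q j)"
    using sum_mult_drop_val[of "\<lambda>j. q j - q (j - 1)" r m] tele by (simp add: mult.commute)
  also have "\<dots> = (\<Sum>j=1..m. drop_val m r j * Q_ExAnte k n G j)"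
    using q by (intro sum.cong) auto
  finally have "(\<Sum>j=1..m. drop_val m r j * Q_ExAnte k n G j) = (\<Sum>j=1..m. r j * (q j - q (j - 1)))"
    by simp
  moreover have "?P (\<lambda>j. q j - q (j - 1))"
    using step tele[of m] by (auto simp: q_def)
  ultimately show "(\<Sum>j=1..m. drop_val m r j * Q_ExAnte k n G j)
      \<in> {(\<Sum>j=1..m. r j * a j) | a. ?P a}" by (intro CollectI exI[of _ "\<lambda>j. q j - q (j - 1)"] conjI) auto
  fix y assume "y \<in> {(\<Sum>j=1..m. r j * a j) | a. ?P a}"
  then obtain a where y: "y = (\<Sum>j=1..m. r j * a j)" and a: "?P a" by auto
  have "y = (\<Sum>j=1..m. drop_val m r j * (\<Sum>b=1..j. a b))"
    unfolding y sum_mult_drop_val[symmetric] by (simp add: mult.commute)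
  also have "\<dots> \<le> (\<Sum>j=1..m. drop_val m r j * Q_ExAnte k n G j)"
  proof (intro sum_mono mult_left_mono drop_val_nonneg[OF I])
    fix j assume j: "j \<in> {1..m}"
    have "(\<Sum>b=1..j. a b) \<le> (\<Sum>b=1..m. a b)" using a j by (intro sum_mono2) auto
    moreover have "(\<Sum>b=1..j. a b) \<le> (\<Sum>b=1..j. \<Sum>i=1..n. p i b)"
      using a j by (intro sum_mono) auto
    moreover have "(\<Sum>b=1..j. \<Sum>i=1..n. p i b) = (\<Sum>i=1..n. \<Sum>b=1..j. p i b)"
      by (rule sum.swap)
    ultimately show "(\<Sum>b=1..j. a b) \<le> Q_ExAnte k n G j"
      using a j q[of j] by (auto simp: q_def)
  qed
  finally show "y \<le> (\<Sum>j=1..m. drop_val m r j * Q_ExAnte k n G j)" .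
qed

subsection \<open>The inner linear program\<close>

definition lp_feasible ::
    "nat \<Rightarrow> nat \<Rightarrow> nat \<Rightarrow> (nat \<Rightarrow> nat \<Rightarrow> real) \<Rightarrow> (nat \<Rightarrow> real) \<Rightarrow> real \<Rightarrow> bool" where
  "lp_feasible k n m G Q \<theta> \<longleftrightarrow>
     (\<exists>\<mu>. prob_space \<mu> \<and> sets \<mu> = sets (policy_space m) \<and>
        (\<forall>j\<in>{1..m}. \<theta> * Q j \<le> (\<integral>z. coverage k n G z j \<partial>\<mu>)))"

lemma innerLP_eq_Sup: "innerLP k n m G Q = Sup {\<theta>. lp_feasible k n m G Q \<theta>}"
  unfolding innerLP_def lp_feasible_def coverage_def
  by (simp add: case_prod_unfold del: y_arr.simps)

lemma coverage_bounds:
  assumes "is_type_dist n m G" "z \<in> {1..m} \<times> {0<..1}" "j \<le> m"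
  shows "0 \<le> coverage k n G z j \<and> coverage k n G z j \<le> real n * real k"
  using assms coverage_mem_Icc[OF assms(1), of "fst z" "snd z" j] by (cases z) auto

lemma lp_feasible_pmf:
  assumes m: "m \<ge> 1" and p: "set_pmf p \<subseteq> {1..m} \<times> {0<..1}"
    and \<theta>: "\<And>j. j \<in> {1..m} \<Longrightarrow> \<theta> * Q j \<le> measure_pmf.expectation p (\<lambda>z. coverage k n G z j)"
  shows "lp_feasible k n m G Q \<theta>"
proof -
  \<comment> \<open>A \<open>pmf\<close> lives on all subsets of the full type, so it is pushed
    forward to the policy space; points outside go to \<open>(1, 1)\<close>, which is a policy since
    \<open>m \<ge> 1\<close>.\<close>
  define f :: "nat \<times> real \<Rightarrow> nat \<times> real"
    where "f z = (if z \<in> {1..m} \<times> {0<..1} then z else (1, 1))" for z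
  have f: "f \<in> measurable (measure_pmf p) (policy_space m)"
    unfolding measurable_pmf_measure1 space_policy_space using m by (auto simp: f_def)
  define \<mu> where "\<mu> = distr (measure_pmf p) (policy_space m) f"
  have "(\<integral>z. coverage k n G z j \<partial>\<mu>) = measure_pmf.expectation p (\<lambda>z. coverage k n G z j)" for j
  proof -
    have "(\<integral>z. coverage k n G z j \<partial>\<mu>) = measure_pmf.expectation p (\<lambda>z. coverage k n G (f z) j)"
      unfolding \<mu>_def by (rule integral_distr[OF f measurable_coverage])
    also have "\<dots> = measure_pmf.expectation p (\<lambda>z. coverage k n G z j)"
      using p by (intro integral_cong_AE) (auto simp: AE_measure_pmf_iff f_def)
    finally show ?thesis .
  qed
  moreover have "prob_space \<mu>"
    unfolding \<mu>_def using f by (rule measure_pmf.prob_space_distr)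
  moreover have "sets \<mu> = sets (policy_space m)" unfolding \<mu>_def by (rule sets_distr)
  ultimately show ?thesis
    unfolding lp_feasible_def using \<theta> by (intro exI[of _ \<mu>]) auto
qed

text \<open>Weight the constraints by \<open>\<Delta>\<close>, add them and exchange sum and
  integral; a bound valid for every pure policy holds on average.\<close>

lemma lp_feasible_weak_duality:
  assumes G: "is_type_dist n m G" and \<theta>: "lp_feasible k n m G Q \<theta>"
    and \<Delta>: "\<And>j. j \<in> {1..m} \<Longrightarrow> 0 \<le> \<Delta> j"
    and B: "\<And>z. z \<in> {1..m} \<times> {0<..1} \<Longrightarrow> (\<Sum>j=1..m. \<Delta> j * coverage k n G z j) \<le> B"
  shows "\<theta> * (\<Sum>j=1..m. \<Delta> j * Q j) \<le> B"
proof -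
  obtain \<mu> where \<mu>: "prob_space \<mu>" "sets \<mu> = sets (policy_space m)"
    and le: "\<And>j. j \<in> {1..m} \<Longrightarrow> \<theta> * Q j \<le> (\<integral>z. coverage k n G z j \<partial>\<mu>)"
    using \<theta> by (auto simp: lp_feasible_def)
  interpret prob_space \<mu> by fact
  have sp: "space \<mu> = {1..m} \<times> {0<..1}"
    using sets_eq_imp_space_eq[OF \<mu>(2)] by (simp only: space_policy_space)
  have int: "integrable \<mu> (\<lambda>z. coverage k n G z j)" if "j \<in> {1..m}" for j
  proof (rule integrable_const_bound)
    show "AE z in \<mu>. norm (coverage k n G z j) \<le> real n * real k"
      using coverage_bounds[OF G, of _ j k] that sp by (intro AE_I2) auto
    show "(\<lambda>z. coverage k n G z j) \<in> borel_measurable \<mu>"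
      using measurable_coverage[of k n G j m] measurable_cong_sets[OF \<mu>(2) refl] by blast
  qed
  have "\<theta> * (\<Sum>j=1..m. \<Delta> j * Q j) = (\<Sum>j=1..m. \<Delta> j * (\<theta> * Q j))"
    by (simp add: sum_distrib_left mult.left_commute)
  also have "\<dots> \<le> (\<Sum>j=1..m. \<Delta> j * (\<integral>z. coverage k n G z j \<partial>\<mu>))"
    using le \<Delta> by (intro sum_mono mult_left_mono) auto
  also have "\<dots> = (\<integral>z. (\<Sum>j=1..m. \<Delta> j * coverage k n G z j) \<partial>\<mu>)"
    using int by (subst Bochner_Integration.integral_sum) auto
  also have "\<dots> \<le> B"
    using int B sp by (intro integral_le_const Bochner_Integration.integrable_sum AE_I2) auto
  finally show ?thesis .
qed

lemma lp_feasible_0: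
  assumes G: "is_type_dist n m G"
  shows "lp_feasible k n m G Q 0"
proof -
  have m: "m \<ge> 1" using G by (simp add: is_type_dist_def)
  then show ?thesis
    using coverage_bounds[OF G, of "(1, 1)"]
    by (intro lp_feasible_pmf[where p = "return_pmf (1, 1)"]) auto
qed

text \<open>The constraint at \<open>m\<close> alone bounds \<open>\<theta>\<close>: weak duality
  with the indicator of \<open>m\<close> as multiplier.\<close>

lemma bdd_above_lp_feasible:
  assumes G: "is_type_dist n m G" and Q: "0 < Q m"
  shows "bdd_above {\<theta>. lp_feasible k n m G Q \<theta>}"
proof (rule bdd_aboveI, clarify)
  fix \<theta> assume \<theta>: "lp_feasible k n m G Q \<theta>"
  have m: "m \<in> {1..m}" using G by (simp add: is_type_dist_def)
  have pick: "(\<Sum>j=1..m. of_bool (j = m) * g j) = g m" for g :: "nat \<Rightarrow> real"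
  proof -
    have "(\<Sum>j=1..m. of_bool (j = m) * g j) = (\<Sum>j=1..m. if j = m then g j else 0)"
      by (intro sum.cong) auto
    with m show ?thesis by simp
  qed
  have "\<theta> * (\<Sum>j=1..m. of_bool (j = m) * Q j) \<le> real n * real k"
  proof (rule lp_feasible_weak_duality[OF G \<theta>])
    show "(\<Sum>j=1..m. of_bool (j = m) * coverage k n G z j) \<le> real n * real k"
      if "z \<in> {1..m} \<times> {0<..1}" for z
      unfolding pick using coverage_bounds[OF G that order_refl] by simp
  qed simp
  then show "\<theta> \<le> real n * real k / Q m"
    unfolding pick using Q by (simp add: pos_le_divide_eq)
qed

lemma innerLP_upper:
  assumes "is_type_dist n m G" "0 < Q m" "lp_feasible k n m G Q \<theta>"
  shows "\<theta> \<le> innerLP k n m G Q"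
  unfolding innerLP_eq_Sup using bdd_above_lp_feasible[of n m G Q k] assms by (intro cSup_upper) auto

section \<open>Comparing instances with the inner program\<close>

lemma policy_value_le_ST:
  assumes I: "is_instance n m r p" and z: "(J, \<rho>) \<in> {1..m} \<times> {0<..1}"
  shows "policy_value k n m r p J \<rho> \<le> ST k n m r p"
proof -
  define G where "G i j = (\<Sum>a=1..j. p i a)" for i j
  have c: "is_cdf_of n m p G" by (simp add: is_cdf_of_def G_def)
  note G = is_type_dist_cdf[OF I c]
  have "bdd_above ((\<lambda>(J, \<rho>). policy_value k n m r p J \<rho>) ` ({1..m} \<times> {0<..1}))"
  proof (rule bdd_aboveI2)
    fix z :: "nat \<times> real" assume z: "z \<in> {1..m} \<times> {0<..1}"
    have "(case z of (J, \<rho>) \<Rightarrow> policy_value k n m r p J \<rho>) = (\<Sum>j=1..m. drop_val m r j * coverage k n G z j)"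
      using z by (auto simp: policy_value_eq_coverage[OF I c])
    also have "\<dots> \<le> (\<Sum>j=1..m. drop_val m r j * (real n * real k))"
      using coverage_bounds[OF G z] drop_val_nonneg[OF I] by (intro sum_mono mult_left_mono) auto
    finally show "(case z of (J, \<rho>) \<Rightarrow> policy_value k n m r p J \<rho>) \<le>
      (\<Sum>j=1..m. drop_val m r j * (real n * real k))" .
  qed
  then show ?thesis
    unfolding ST_def using cSUP_upper[OF z] by fastforce
qed

text \<open>Weak duality with the drops of \<open>r\<close> as multipliers and \<open>ST\<close> as
  the bound over pure policies.\<close>

lemma innerLP_le_ratio:
  assumes I: "is_instance n m r p" and c: "is_cdf_of n m p G"
    and D: "D = (\<Sum>j=1..m. drop_val m r j * Q j)" "D > 0"
  shows "innerLP k n m G Q \<le> ST k n m r p / D"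
  unfolding innerLP_eq_Sup
proof (rule cSup_least)
  note G = is_type_dist_cdf[OF I c]
  show "{\<theta>. lp_feasible k n m G Q \<theta>} \<noteq> {}" using lp_feasible_0[OF G] by auto
  fix \<theta> assume "\<theta> \<in> {\<theta>. lp_feasible k n m G Q \<theta>}"
  then have \<theta>: "lp_feasible k n m G Q \<theta>" by simp
  have "(\<Sum>j=1..m. drop_val m r j * coverage k n G z j) \<le> ST k n m r p"
    if "z \<in> {1..m} \<times> {0<..1}" for z
    using that policy_value_le_ST[OF I, of "fst z" "snd z" k]
      policy_value_eq_coverage[OF I c, of "fst z" "snd z" k] by auto
  then have "\<theta> * D \<le> ST k n m r p"
    unfolding D(1) by (intro lp_feasible_weak_duality[OF G \<theta>] drop_val_nonneg[OF I])
  then show "\<theta> \<le> ST k n m r p / D" using D(2) by (simp add: field_simps)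
qed

text \<open>The strong direction: the multipliers from \<open>approximate_lp_duality\<close> become
  the drops of the valuations, and the increments of \<open>G\<close> become the type
  probabilities.\<close>

lemma ex_instance_ratio_le:
  assumes G: "is_type_dist n m G" and Q: "\<And>j. j \<in> {1..m} \<Longrightarrow> 0 \<le> Q j" "0 < Q m" and e: "e > 0"
  obtains r p where "is_instance n m r p" "is_cdf_of n m p G"
    "0 < (\<Sum>j=1..m. drop_val m r j * Q j)"
    "ST k n m r p \<le> (innerLP k n m G Q + e) * (\<Sum>j=1..m. drop_val m r j * Q j)"
proof -
  have m: "m \<ge> 1" using G by (simp add: is_type_dist_def)
  \<comment> \<open>Duality asks for positive \<open>Q\<close>. A type with \<open>Q j = 0\<close>
    only demands nonnegative coverage, which always holds, so its multiplier can be 0. The set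
    contains \<open>m\<close>.\<close>
  define A where "A = {j\<in>{1..m}. 0 < Q j}"
  let ?X = "{1..m} \<times> {0<..1::real}"
  have A: "finite A" "A \<noteq> {}" using m Q by (auto simp: A_def)
  have X: "?X \<noteq> {}" using m by auto
  have v: "\<theta> \<le> innerLP k n m G Q"
    if p: "finite (set_pmf p)" "set_pmf p \<subseteq> ?X" and \<theta>: "\<And>j. j \<in> A \<Longrightarrow>
      \<theta> * Q j \<le> measure_pmf.expectation p (\<lambda>z. coverage k n G z j)" for p \<theta>
  proof (rule innerLP_upper[of n m G Q k, OF G Q(2)], rule lp_feasible_pmf[OF m p(2)])
    fix j assume j: "j \<in> {1..m}"
    show "\<theta> * Q j \<le> measure_pmf.expectation p (\<lambda>z. coverage k n G z j)"
    proof (cases "j \<in> A")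
      case False
      with Q(1)[OF j] j have "Q j = 0" by (simp add: A_def)
      moreover have "0 \<le> measure_pmf.expectation p (\<lambda>z. coverage k n G z j)"
        using coverage_bounds[OF G, of _ j k] p j
        by (intro integral_nonneg_AE) (auto simp: AE_measure_pmf_iff)
      ultimately show ?thesis by simp
    qed (rule \<theta>)
  qed
  obtain \<Delta> where \<Delta>: "\<And>j. j \<in> A \<Longrightarrow> 0 \<le> \<Delta> j" "0 < (\<Sum>j\<in>A. \<Delta> j * Q j)"
    "\<And>z. z \<in> ?X \<Longrightarrow> (\<Sum>j\<in>A. \<Delta> j * coverage k n G z j) \<le> (innerLP k n m G Q + e) * (\<Sum>j\<in>A. \<Delta> j * Q j)"
  proof (rule approximate_lp_duality[where c = "coverage k n G" and Q = Q and A = A and X = ?X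
        and B = "real n * real k" and v = "innerLP k n m G Q" and e = e])
    show "0 \<le> coverage k n G z j \<and> coverage k n G z j \<le> real n * real k" if "z \<in> ?X" "j \<in> A" for z j
      using that coverage_bounds[OF G] by (simp add: A_def)
  qed (use A X v e in \<open>auto simp: A_def\<close>)
  define \<Delta>' where "\<Delta>' j = (if j \<in> A then \<Delta> j else 0)" for j
  \<comment> \<open>Tail sums, so that the drops of \<open>r\<close> are exactly
    \<open>\<Delta>'\<close>; nonnegativity of \<open>\<Delta>'\<close> makes \<open>r\<close>
    nonincreasing.\<close>
  define r where "r j = (\<Sum>b=j..m. \<Delta>' b)" for j
  define p where "p = (\<lambda>i j. G i j - G i (j - 1))"
  have sumA: "(\<Sum>j=1..m. \<Delta>' j * g j) = (\<Sum>j\<in>A. \<Delta> j * g j)" for g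
    by (rule sum.mono_neutral_cong_right) (auto simp: A_def \<Delta>'_def)
  have drop: "drop_val m r j = \<Delta>' j" if "j \<in> {1..m}" for j
  proof -
    have "(\<Sum>b=j..m. \<Delta>' b) = \<Delta>' j + (\<Sum>b=Suc j..m. \<Delta>' b)"
      using that by (intro sum.atLeast_Suc_atMost) auto
    then show ?thesis using that by (auto simp: drop_val_def r_def)
  qed
  have dropsum: "(\<Sum>j=1..m. drop_val m r j * g j) = (\<Sum>j\<in>A. \<Delta> j * g j)" for g
    unfolding sumA[symmetric] using drop by (intro sum.cong) auto
  have c: "is_cdf_of n m p G" unfolding p_def by (rule is_cdf_of_increments[OF G])
  have I: "is_instance n m r p"
    unfolding is_instance_def
  proof (intro conjI ballI impI)
    show "1 \<le> m" by (rule m)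
    have nn: "0 \<le> \<Delta>' j" for j using \<Delta>(1) by (simp add: \<Delta>'_def)
    show "0 \<le> r j" for j unfolding r_def using nn by (intro sum_nonneg) auto
    show "r j' \<le> r j" if "j \<le> j'" for j j'
      unfolding r_def using nn that by (intro sum_mono2) auto
    show "0 \<le> p i j" if "i \<in> {1..n}" "j \<in> {1..m}" for i j
      using is_type_dist_mono[OF G that(1), of "j - 1" j] that by (simp add: p_def)
    show "(\<Sum>j=1..m. p i j) = 1" if "i \<in> {1..n}" for i
      using c G that by (auto simp: is_cdf_of_def is_type_dist_def)
  qed
  have "ST k n m r p \<le> (innerLP k n m G Q + e) * (\<Sum>j=1..m. drop_val m r j * Q j)"
    unfolding ST_def
  proof (rule cSUP_least[OF X])
    fix z assume z: "z \<in> ?X"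
    then have "(case z of (J, \<rho>) \<Rightarrow> policy_value k n m r p J \<rho>) = (\<Sum>j\<in>A. \<Delta> j * coverage k n G z j)"
      unfolding dropsum[symmetric] by (auto simp: policy_value_eq_coverage[OF I c])
    then show "(case z of (J, \<rho>) \<Rightarrow> policy_value k n m r p J \<rho>) \<le>
        (innerLP k n m G Q + e) * (\<Sum>j=1..m. drop_val m r j * Q j)"
      unfolding dropsum using \<Delta>(3)[OF z] by simp
  qed
  then show thesis using that[OF I c] \<Delta>(2) unfolding dropsum by blast
qed

text \<open>The benchmark enters only through its Abel form and the signs of \<open>Q\<close>, so
  one argument serves both equalities. Each ratio dominates some inner value, and each inner value
  is reached by ratios up to any \<open>e > 0\<close>.\<close>

lemma Inf_ratio_eq_Inf_innerLP:
  assumes D: "\<And>m r p G. is_instance n m r p \<Longrightarrow> is_cdf_of n m p G \<Longrightarrow>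
      D m r p = (\<Sum>j=1..m. drop_val m r j * Q G j)"
    and Q: "\<And>m G j. is_type_dist n m G \<Longrightarrow> j \<in> {1..m} \<Longrightarrow> 0 \<le> Q G j"
      "\<And>m G. is_type_dist n m G \<Longrightarrow> 0 < Q G m"
  shows "Inf {ST k n m r p / D m r p | m r p. is_instance n m r p \<and> D m r p > 0} =
         Inf {innerLP k n m G (Q G) | m G. is_type_dist n m G}"
    (is "Inf ?S = Inf ?L")
proof -
  have L0: "0 \<le> y" if "y \<in> ?L" for y
    using that innerLP_upper[OF _ _ lp_feasible_0] Q(2) by fastforce
  have below: "\<exists>y\<in>?L. y \<le> x" if "x \<in> ?S" for x
  proof -
    obtain m r p where x: "x = ST k n m r p / D m r p" and I: "is_instance n m r p"
      and pos: "D m r p > 0" using \<open>x \<in> ?S\<close> by blast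
    define G where "G i j = (\<Sum>a=1..j. p i a)" for i j
    have c: "is_cdf_of n m p G" by (simp add: is_cdf_of_def G_def)
    have "innerLP k n m G (Q G) \<le> x"
      unfolding x by (rule innerLP_le_ratio[OF I c D[OF I c] pos])
    then show ?thesis using is_type_dist_cdf[OF I c] by auto
  qed
  have above: "\<exists>x\<in>?S. x \<le> y + e" if "y \<in> ?L" and e: "e > 0" for y e
  proof -
    obtain m G where y: "y = innerLP k n m G (Q G)" and G: "is_type_dist n m G"
      using \<open>y \<in> ?L\<close> by auto
    obtain r p where I: "is_instance n m r p" and c: "is_cdf_of n m p G"
      and pos: "0 < (\<Sum>j=1..m. drop_val m r j * Q G j)"
      and le: "ST k n m r p \<le> (y + e) * (\<Sum>j=1..m. drop_val m r j * Q G j)"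
      using ex_instance_ratio_le[where Q = "Q G" and k = k, OF G Q(1)[OF G] Q(2)[OF G] e]
      unfolding y by blast
    have "D m r p > 0" "ST k n m r p / D m r p \<le> y + e"
      using pos le by (auto simp: D[OF I c] field_simps)
    with I show ?thesis by blast
  qed
  \<comment> \<open>Real infima need nonempty sets bounded below. The distribution with a single
    type is a witness for \<open>?L\<close>; \<open>above\<close> then yields one for
    \<open>?S\<close>.\<close>
  have "is_type_dist n 1 (\<lambda>i j. of_bool (1 \<le> j))" by (auto simp: is_type_dist_def)
  then have Lne: "?L \<noteq> {}" by blast
  then obtain y where "y \<in> ?L" by blast
  from above[OF this zero_less_one] have Sne: "?S \<noteq> {}" by blast
  have Lb: "bdd_below ?L" using L0 by (rule bdd_belowI)
  have Sb: "bdd_below ?S" using below L0 by (intro bdd_belowI[of _ 0]) (meson order_trans)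
  show ?thesis
  proof (rule antisym)
    show "Inf ?S \<le> Inf ?L"
    proof (rule cInf_greatest[OF Lne], rule field_le_epsilon)
      fix y e :: real assume "y \<in> ?L" "0 < e"
      then obtain x where "x \<in> ?S" "x \<le> y + e" using above by blast
      then show "Inf ?S \<le> y + e" by (rule cInf_lower2[OF _ _ Sb])
    qed
    show "Inf ?L \<le> Inf ?S"
    proof (rule cInf_greatest[OF Sne])
      fix x assume "x \<in> ?S"
      then obtain y where "y \<in> ?L" "y \<le> x" using below by blast
      then show "Inf ?L \<le> x" by (rule cInf_lower2[OF _ _ Lb])
    qed
  qed
qed

section \<open>Signs of the benchmark coefficients\<close>

lemma Q_ExAnte_nonneg:
  assumes "is_type_dist n m G" "j \<in> {1..m}"
  shows "0 \<le> Q_ExAnte k n G j"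
  using is_type_dist_mem_Icc[OF assms(1)] assms(2) by (auto simp: Q_ExAnte_def intro!: sum_nonneg)

lemma Q_ExAnte_last_pos:
  assumes "is_type_dist n m G" "k \<ge> 1" "n \<ge> 1"
  shows "0 < Q_ExAnte k n G m"
  using assms by (simp add: Q_ExAnte_def is_type_dist_def)

lemma Q_Proph_nonneg: "0 \<le> Q_Proph k n G j"
  unfolding Q_Proph_def by (intro integral_nonneg_AE AE_I2) (auto intro!: sum_nonneg)

text \<open>At level \<open>m\<close> every coin shows \<open>True\<close> surely, so the
  expectation is the minimum of \<open>n\<close> and \<open>k\<close>.\<close>

lemma Q_Proph_last_pos:
  assumes G: "is_type_dist n m G" and "k \<ge> 1" "n \<ge> 1"
  shows "0 < Q_Proph k n G m"
proof -
  have "bernoulli_pmf 1 = return_pmf True"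
    by (rule pmf_eqI) (auto simp: pmf_bernoulli_True indicator_def split: bool.split)
  then have "Pi_pmf {1..n} False (\<lambda>i. bernoulli_pmf (G i m)) = Pi_pmf {1..n} False (\<lambda>_. return_pmf True)"
    using G by (intro Pi_pmf_cong) (auto simp: is_type_dist_def)
  moreover have "{i. Suc 0 \<le> i \<and> i \<le> n} = {1..n}" by auto
  ultimately show ?thesis using assms(2,3) by (simp add: Q_Proph_def Int_def)
qed

theorem theorem3:
  fixes k n :: nat
  assumes "k \<ge> 1" and "n > k"
  shows "Inf {ST k n m r p / Proph k n m r p | m r p. is_instance n m r p \<and> Proph k n m r p > 0} =
           Inf {innerLP_ST_Proph k n m G | m G. is_type_dist n m G} \<and>
         Inf {ST k n m r p / ExAnte k n m r p | m r p. is_instance n m r p \<and> ExAnte k n m r p > 0} =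
           Inf {innerLP_ST_ExAnte k n m G | m G. is_type_dist n m G}"
  unfolding innerLP_ST_Proph_def innerLP_ST_ExAnte_def
proof
  show "Inf {ST k n m r p / Proph k n m r p | m r p. is_instance n m r p \<and> Proph k n m r p > 0} =
        Inf {innerLP k n m G (Q_Proph k n G) | m G. is_type_dist n m G}"
    using assms by (intro Inf_ratio_eq_Inf_innerLP Proph_eq Q_Proph_nonneg Q_Proph_last_pos) auto
  show "Inf {ST k n m r p / ExAnte k n m r p | m r p. is_instance n m r p \<and> ExAnte k n m r p > 0} =
        Inf {innerLP k n m G (Q_ExAnte k n G) | m G. is_type_dist n m G}"
    using assms by (intro Inf_ratio_eq_Inf_innerLP ExAnte_eq Q_ExAnte_nonneg Q_ExAnte_last_pos) auto
qed

end
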